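(* Let $L \colon \mathcal{A} \to \mathcal{C}$ and $U \colon \mathcal{C} \to \mathcal{A}$ be functors forming an adjunction $L \dashv U$ with counit $\epsilon \colon LU \to \mathrm{id}_{\mathcal{C}}$. If $\epsilon$ is a cartesian natural transformation, then the functor $LU \colon \mathcal{C} \to \mathcal{C}$ preserves effective descent morphisms.
   Context: A morphism $p \colon a \to b$ in a category $\mathcal{X}$ is an effective descent morphism if all pullbacks along $p$ exist in $\mathcal{X}$ (equivalently, the functor $p_! \colon \mathcal{X} \downarrow a \to \mathcal{X} \downarrow b$, $f \mapsto p \circ f$, between slice categories has a right adjoint $p^*$, given by pullback along $p$) and the functor $p^* \colon \mathcal{X}\downarrow b \to \mathcal{X} \downarrow a$ is monadic (its comparison functor into the Eilenberg-Moore category of the monad induced by $p_! \dashv p^*$ is an equivalence). No existence of other pullbacks in $\mathcal{X}$ is assumed. A functor $F$ preserves effective descent morphisms if $F(p)$ is an effective descent morphism whenever $p$ is. A natural transformation is cartesian if all of its naturality squares are pullback squares. *)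

theory Defs
  imports Main
begin

text \<open>
  Objects and arrows are carved out of two types by carrier sets. The operations are only
  constrained on the carriers, and \<open>g \<cdot> f\<close> only where \<open>Dom g = Cod f\<close>.
\<close>

record ('o, 'm) cat =
  Obj :: "'o set"
  Arr :: "'m set"
  Dom :: "'m \<Rightarrow> 'o"
  Cod :: "'m \<Rightarrow> 'o"
  Ident :: "'o \<Rightarrow> 'm"
  Comp :: "'m \<Rightarrow> 'm \<Rightarrow> 'm"  (infixl \<open>\<cdot>\<index>\<close> 70)

definition Hom :: "('o, 'm) cat \<Rightarrow> 'o \<Rightarrow> 'o \<Rightarrow> 'm set"
  where "Hom C x y = {f \<in> Arr C. Dom C f = x \<and> Cod C f = y}"

locale category =
  fixes C :: "('o, 'm) cat" (structure)
  assumes dom_obj: "f \<in> Arr C \<Longrightarrow> Dom C f \<in> Obj C"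
    and cod_obj: "f \<in> Arr C \<Longrightarrow> Cod C f \<in> Obj C"
    and ident_hom: "x \<in> Obj C \<Longrightarrow> Ident C x \<in> Hom C x x"
    and comp_hom: "f \<in> Hom C x y \<Longrightarrow> g \<in> Hom C y z \<Longrightarrow> g \<cdot> f \<in> Hom C x z"
    and ident_left: "f \<in> Hom C x y \<Longrightarrow> Ident C y \<cdot> f = f"
    and ident_right: "f \<in> Hom C x y \<Longrightarrow> f \<cdot> Ident C x = f"
    and comp_assoc: "f \<in> Hom C w x \<Longrightarrow> g \<in> Hom C x y \<Longrightarrow> h \<in> Hom C y z \<Longrightarrow>
      h \<cdot> (g \<cdot> f) = h \<cdot> g \<cdot> f"

definition is_iso :: "('o, 'm) cat \<Rightarrow> 'm \<Rightarrow> bool"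
  where "is_iso C f \<longleftrightarrow> f \<in> Arr C \<and>
    (\<exists>g \<in> Hom C (Cod C f) (Dom C f).
      g \<cdot>\<^bsub>C\<^esub> f = Ident C (Dom C f) \<and> f \<cdot>\<^bsub>C\<^esub> g = Ident C (Cod C f))"

record ('o1, 'm1, 'o2, 'm2) func =
  OMap :: "'o1 \<Rightarrow> 'o2"
  AMap :: "'m1 \<Rightarrow> 'm2"

locale is_functor = dom: category C + cod: category D
  for C :: "('o1, 'm1) cat" and D :: "('o2, 'm2) cat" +
  fixes F :: "('o1, 'm1, 'o2, 'm2) func"
  assumes omap_obj: "x \<in> Obj C \<Longrightarrow> OMap F x \<in> Obj D"
    and amap_hom: "f \<in> Hom C x y \<Longrightarrow> AMap F f \<in> Hom D (OMap F x) (OMap F y)"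
    and amap_ident: "x \<in> Obj C \<Longrightarrow> AMap F (Ident C x) = Ident D (OMap F x)"
    and amap_comp: "f \<in> Hom C x y \<Longrightarrow> g \<in> Hom C y z \<Longrightarrow>
      AMap F (g \<cdot>\<^bsub>C\<^esub> f) = AMap F g \<cdot>\<^bsub>D\<^esub> AMap F f"

definition id_func :: "('o, 'm, 'o, 'm) func"
  where "id_func = \<lparr>OMap = (\<lambda>x. x), AMap = (\<lambda>f. f)\<rparr>"

definition comp_func ::
  "('o2, 'm2, 'o3, 'm3) func \<Rightarrow> ('o1, 'm1, 'o2, 'm2) func \<Rightarrow> ('o1, 'm1, 'o3, 'm3) func"
    (infixl \<open>\<odot>\<close> 70)
  where "G \<odot> F = \<lparr>OMap = (\<lambda>x. OMap G (OMap F x)), AMap = (\<lambda>f. AMap G (AMap F f))\<rparr>"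

locale nat_trans = source: is_functor C D F + target: is_functor C D G
  for C :: "('o1, 'm1) cat" and D :: "('o2, 'm2) cat" and F G +
  fixes \<tau> :: "'o1 \<Rightarrow> 'm2"
  assumes component_hom: "x \<in> Obj C \<Longrightarrow> \<tau> x \<in> Hom D (OMap F x) (OMap G x)"
    and naturality: "f \<in> Hom C x y \<Longrightarrow> \<tau> y \<cdot>\<^bsub>D\<^esub> AMap F f = AMap G f \<cdot>\<^bsub>D\<^esub> \<tau> x"

definition nat_iso where
  "nat_iso C D F G \<tau> \<longleftrightarrow> nat_trans C D F G \<tau> \<and> (\<forall>x \<in> Obj C. is_iso D (\<tau> x))"

definition is_equivalence ::
  "('o1, 'm1) cat \<Rightarrow> ('o2, 'm2) cat \<Rightarrow> ('o1, 'm1, 'o2, 'm2) func \<Rightarrow> bool"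
  where "is_equivalence C D F \<longleftrightarrow> is_functor C D F \<and>
    (\<exists>G. is_functor D C G \<and>
      (\<exists>\<sigma>. nat_iso C C id_func (G \<odot> F) \<sigma>) \<and>
      (\<exists>\<tau>. nat_iso D D (F \<odot> G) id_func \<tau>))"

text \<open>\<open>is_pullback C f g u v\<close>: the square \<open>f \<cdot> u = g \<cdot> v\<close> is a pullback of the cospan \<open>(f, g)\<close>.\<close>

definition is_pullback :: "('o, 'm) cat \<Rightarrow> 'm \<Rightarrow> 'm \<Rightarrow> 'm \<Rightarrow> 'm \<Rightarrow> bool"
  where "is_pullback C f g u v \<longleftrightarrow>
    f \<in> Arr C \<and> g \<in> Arr C \<and> Cod C f = Cod C g \<and>
    u \<in> Arr C \<and> Cod C u = Dom C f \<and>
    v \<in> Arr C \<and> Cod C v = Dom C g \<and>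
    Dom C u = Dom C v \<and> f \<cdot>\<^bsub>C\<^esub> u = g \<cdot>\<^bsub>C\<^esub> v \<and>
    (\<forall>z \<in> Obj C. \<forall>s \<in> Hom C z (Dom C f). \<forall>t \<in> Hom C z (Dom C g).
      f \<cdot>\<^bsub>C\<^esub> s = g \<cdot>\<^bsub>C\<^esub> t \<longrightarrow>
      (\<exists>!h. h \<in> Hom C z (Dom C u) \<and> u \<cdot>\<^bsub>C\<^esub> h = s \<and> v \<cdot>\<^bsub>C\<^esub> h = t))"

definition has_pullbacks_along :: "('o, 'm) cat \<Rightarrow> 'm \<Rightarrow> bool"
  where "has_pullbacks_along C p \<longleftrightarrow>
    (\<forall>f \<in> Arr C. Cod C f = Cod C p \<longrightarrow> (\<exists>u v. is_pullback C p f u v))"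

definition cartesian_nat_trans where
  "cartesian_nat_trans C D F G \<tau> \<longleftrightarrow> nat_trans C D F G \<tau> \<and>
    (\<forall>x y. \<forall>f \<in> Hom C x y. is_pullback D (\<tau> y) (AMap G f) (AMap F f) (\<tau> x))"

text \<open>\<open>adjunction A C L U \<eta> \<epsilon>\<close>: \<open>L \<stileturn> U\<close> with unit \<open>\<eta>\<close> and counit \<open>\<epsilon>\<close>, where \<open>L : A \<rightarrow> C\<close>.\<close>

locale adjunction = left: is_functor A C L + right: is_functor C A U +
  unit: nat_trans A A id_func "U \<odot> L" \<eta> +
  counit: nat_trans C C "L \<odot> U" id_func \<epsilon>
  for A :: "('oa, 'ma) cat" and C :: "('oc, 'mc) cat" and L U \<eta> \<epsilon> +
  assumes triangle_left: "x \<in> Obj A \<Longrightarrow>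
      \<epsilon> (OMap L x) \<cdot>\<^bsub>C\<^esub> AMap L (\<eta> x) = Ident C (OMap L x)"
    and triangle_right: "y \<in> Obj C \<Longrightarrow>
      AMap U (\<epsilon> y) \<cdot>\<^bsub>A\<^esub> \<eta> (OMap U y) = Ident A (OMap U y)"

record ('o, 'm) monad_data =
  Func :: "('o, 'm, 'o, 'm) func"
  Unit :: "'o \<Rightarrow> 'm"
  Mult :: "'o \<Rightarrow> 'm"

locale monad = unit: nat_trans X X id_func "Func T" "Unit T" +
  mult: nat_trans X X "Func T \<odot> Func T" "Func T" "Mult T"
  for X :: "('o, 'm) cat" and T :: "('o, 'm) monad_data" +
  assumes mult_unit_left: "x \<in> Obj X \<Longrightarrow>
      Mult T x \<cdot>\<^bsub>X\<^esub> AMap (Func T) (Unit T x) = Ident X (OMap (Func T) x)"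
    and mult_unit_right: "x \<in> Obj X \<Longrightarrow>
      Mult T x \<cdot>\<^bsub>X\<^esub> Unit T (OMap (Func T) x) = Ident X (OMap (Func T) x)"
    and mult_assoc: "x \<in> Obj X \<Longrightarrow>
      Mult T x \<cdot>\<^bsub>X\<^esub> AMap (Func T) (Mult T x)
        = Mult T x \<cdot>\<^bsub>X\<^esub> Mult T (OMap (Func T) x)"

definition induced_monad where
  "induced_monad L U \<eta> \<epsilon> =
    \<lparr>Func = U \<odot> L, Unit = \<eta>, Mult = (\<lambda>x. AMap U (\<epsilon> (OMap L x)))\<rparr>"

lemma induced_monad_is_monad:
  assumes "adjunction X Y L U \<eta> \<epsilon>"
  shows "monad X (induced_monad L U \<eta> \<epsilon>)"
proof -
  interpret adjunction X Y L U \<eta> \<epsilon> by fact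
  have c: "\<epsilon> y \<in> Hom Y (OMap L (OMap U y)) y" if "y \<in> Obj Y" for y
    using counit.component_hom[OF that] by (simp add: comp_func_def id_func_def)
  have n: "\<epsilon> z \<cdot>\<^bsub>Y\<^esub> AMap L (AMap U g) = g \<cdot>\<^bsub>Y\<^esub> \<epsilon> y" if "g \<in> Hom Y y z" for g y z
    using counit.naturality[OF that] by (simp add: comp_func_def id_func_def)
  have u: "\<eta> x \<in> Hom X x (OMap U (OMap L x))" if "x \<in> Obj X" for x
    using unit.component_hom[OF that] by (simp add: comp_func_def id_func_def)
  note o = left.omap_obj right.omap_obj
  let ?T = "induced_monad L U \<eta> \<epsilon>"
  have T: "Func ?T = U \<odot> L" "Unit ?T = \<eta>" "Mult ?T = (\<lambda>x. AMap U (\<epsilon> (OMap L x)))"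
    by (simp_all add: induced_monad_def)
  have TT: "is_functor X X (U \<odot> L \<odot> (U \<odot> L))"
  proof unfold_locales
    fix f x y g z
    assume f: "f \<in> Hom X x y" and g: "g \<in> Hom X y z"
    note UL = right.amap_hom[OF left.amap_hom]
    show "AMap (U \<odot> L \<odot> (U \<odot> L)) (g \<cdot>\<^bsub>X\<^esub> f) =
        AMap (U \<odot> L \<odot> (U \<odot> L)) g \<cdot>\<^bsub>X\<^esub> AMap (U \<odot> L \<odot> (U \<odot> L)) f"
      using left.amap_comp[OF f g] right.amap_comp[OF left.amap_hom[OF f] left.amap_hom[OF g]]
        left.amap_comp[OF UL[OF f] UL[OF g]]
        right.amap_comp[OF left.amap_hom[OF UL[OF f]] left.amap_hom[OF UL[OF g]]]
      by (simp add: comp_func_def)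
  qed (auto simp: comp_func_def o right.amap_ident left.amap_ident
      intro: right.amap_hom left.amap_hom)
  have mult: "nat_trans X X (U \<odot> L \<odot> (U \<odot> L)) (U \<odot> L) (Mult ?T)"
  proof -
    interpret TT: is_functor X X "U \<odot> L \<odot> (U \<odot> L)" by (rule TT)
    show ?thesis
    proof
      fix x assume "x \<in> Obj X"
      then show "Mult ?T x \<in> Hom X (OMap (U \<odot> L \<odot> (U \<odot> L)) x) (OMap (U \<odot> L) x)"
        using right.amap_hom[OF c] by (simp add: T comp_func_def o)
    next
      fix f x y assume f: "f \<in> Hom X x y"
      then have xy: "x \<in> Obj X" "y \<in> Obj X"
        using left.dom.dom_obj left.dom.cod_obj by (auto simp: Hom_def)
      have Lf: "AMap L f \<in> Hom Y (OMap L x) (OMap L y)" using left.amap_hom[OF f] .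
      have LULf: "AMap L (AMap U (AMap L f)) \<in>
          Hom Y (OMap L (OMap U (OMap L x))) (OMap L (OMap U (OMap L y)))"
        using left.amap_hom[OF right.amap_hom[OF Lf]] .
      show "Mult ?T y \<cdot>\<^bsub>X\<^esub> AMap (U \<odot> L \<odot> (U \<odot> L)) f = AMap (U \<odot> L) f \<cdot>\<^bsub>X\<^esub> Mult ?T x"
        using right.amap_comp[OF LULf c] right.amap_comp[OF c Lf] n[OF Lf] xy
        by (simp add: T comp_func_def o)
    qed
  qed
  show ?thesis
    unfolding monad_def T(1,2)
  proof (intro conjI)
    show "nat_trans X X id_func (U \<odot> L) \<eta>" by (rule unit.nat_trans_axioms)
    show "nat_trans X X (U \<odot> L \<odot> (U \<odot> L)) (U \<odot> L) (Mult ?T)" by (rule mult)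
    show "monad_axioms X ?T"
    proof
      fix x assume x: "x \<in> Obj X"
      then have Lx: "OMap L x \<in> Obj Y" by (rule o)
      have e: "\<epsilon> (OMap L x) \<in> Hom Y (OMap L (OMap U (OMap L x))) (OMap L x)" using c[OF Lx] .
      have Le: "AMap L (AMap U (\<epsilon> (OMap L x))) \<in> Hom Y
          (OMap L (OMap U (OMap L (OMap U (OMap L x))))) (OMap L (OMap U (OMap L x)))"
        using left.amap_hom[OF right.amap_hom[OF e]] .
      have e2: "\<epsilon> (OMap L (OMap U (OMap L x))) \<in> Hom Y
          (OMap L (OMap U (OMap L (OMap U (OMap L x))))) (OMap L (OMap U (OMap L x)))"
        using c x by (simp add: o)
      show "Mult ?T x \<cdot>\<^bsub>X\<^esub> AMap (Func ?T) (Unit ?T x) = Ident X (OMap (Func ?T) x)"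
        using right.amap_comp[OF left.amap_hom[OF u[OF x]] e] triangle_left[OF x]
          right.amap_ident[OF Lx] by (simp add: T comp_func_def)
      show "Mult ?T x \<cdot>\<^bsub>X\<^esub> Unit ?T (OMap (Func ?T) x) = Ident X (OMap (Func ?T) x)"
        using triangle_right[OF Lx] by (simp add: T comp_func_def)
      show "Mult ?T x \<cdot>\<^bsub>X\<^esub> AMap (Func ?T) (Mult ?T x)
          = Mult ?T x \<cdot>\<^bsub>X\<^esub> Mult ?T (OMap (Func ?T) x)"
        using right.amap_comp[OF Le e] right.amap_comp[OF e2 e] n[OF e]
        by (simp add: T comp_func_def)
    qed
  qed
qed

definition is_algebra :: "('o, 'm) cat \<Rightarrow> ('o, 'm) monad_data \<Rightarrow> 'o \<times> 'm \<Rightarrow> bool"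
  where "is_algebra X T = (\<lambda>(x, h).
    x \<in> Obj X \<and> h \<in> Hom X (OMap (Func T) x) x \<and>
    h \<cdot>\<^bsub>X\<^esub> Unit T x = Ident X x \<and>
    h \<cdot>\<^bsub>X\<^esub> AMap (Func T) h = h \<cdot>\<^bsub>X\<^esub> Mult T x)"

text \<open>
  An arrow of a derived category (Eilenberg-Moore or slice) is a triple carrying its source and
  target, since the underlying arrow alone does not determine them.
\<close>

definition eilenberg_moore ::
  "('o, 'm) cat \<Rightarrow> ('o, 'm) monad_data \<Rightarrow>
    ('o \<times> 'm, ('o \<times> 'm) \<times> 'm \<times> ('o \<times> 'm)) cat"
  where "eilenberg_moore X T =
    \<lparr>Obj = {a. is_algebra X T a},
     Arr = {(a, f, b). is_algebra X T a \<and> is_algebra X T b \<and> f \<in> Hom X (fst a) (fst b) \<and>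
       f \<cdot>\<^bsub>X\<^esub> snd a = snd b \<cdot>\<^bsub>X\<^esub> AMap (Func T) f},
     Dom = (\<lambda>(a, f, b). a),
     Cod = (\<lambda>(a, f, b). b),
     Ident = (\<lambda>a. (a, Ident X (fst a), a)),
     Comp = (\<lambda>(b, g, c) (a, f, b'). (a, g \<cdot>\<^bsub>X\<^esub> f, c))\<rparr>"

definition comparison ::
  "('oy, 'my) cat \<Rightarrow> ('oy, 'my, 'ox, 'mx) func \<Rightarrow> ('oy \<Rightarrow> 'my) \<Rightarrow>
    ('oy, 'my, 'ox \<times> 'mx, ('ox \<times> 'mx) \<times> 'mx \<times> ('ox \<times> 'mx)) func"
  where "comparison Y U \<epsilon> =
    (let K = (\<lambda>y. (OMap U y, AMap U (\<epsilon> y))) in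
      \<lparr>OMap = K, AMap = (\<lambda>f. (K (Dom Y f), AMap U f, K (Cod Y f)))\<rparr>)"

definition monadic_adjunction where
  "monadic_adjunction X Y L U \<eta> \<epsilon> \<longleftrightarrow> adjunction X Y L U \<eta> \<epsilon> \<and>
    is_equivalence Y (eilenberg_moore X (induced_monad L U \<eta> \<epsilon>)) (comparison Y U \<epsilon>)"

definition slice :: "('o, 'm) cat \<Rightarrow> 'o \<Rightarrow> ('m, 'm \<times> 'm \<times> 'm) cat"
  where "slice X b =
    \<lparr>Obj = {f \<in> Arr X. Cod X f = b},
     Arr = {(f, h, g). f \<in> Arr X \<and> Cod X f = b \<and> g \<in> Arr X \<and> Cod X g = b \<and>
       h \<in> Hom X (Dom X f) (Dom X g) \<and> g \<cdot>\<^bsub>X\<^esub> h = f},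
     Dom = (\<lambda>(f, h, g). f),
     Cod = (\<lambda>(f, h, g). g),
     Ident = (\<lambda>f. (f, Ident X (Dom X f), f)),
     Comp = (\<lambda>(g, k, g') (f, h, f'). (f, k \<cdot>\<^bsub>X\<^esub> h, g'))\<rparr>"

text \<open>The functor \<open>p\<^sub>! : X \<down> a \<rightarrow> X \<down> b\<close> for \<open>p : a \<rightarrow> b\<close>.\<close>

definition postcomp :: "('o, 'm) cat \<Rightarrow> 'm \<Rightarrow> ('m, 'm \<times> 'm \<times> 'm, 'm, 'm \<times> 'm \<times> 'm) func"
  where "postcomp X p =
    \<lparr>OMap = (\<lambda>f. p \<cdot>\<^bsub>X\<^esub> f), AMap = (\<lambda>(f, h, g). (p \<cdot>\<^bsub>X\<^esub> f, h, p \<cdot>\<^bsub>X\<^esub> g))\<rparr>"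

text \<open>
  The functor \<open>R\<close> below is \<open>p\<^sup>*\<close>: it is determined up to isomorphism as a right adjoint of \<open>p\<^sub>!\<close>,
  and \<open>right_adjoint_pullback\<close> shows that it is given by pullback along \<open>p\<close>.
\<close>

definition effective_descent :: "('o, 'm) cat \<Rightarrow> 'm \<Rightarrow> bool"
  where "effective_descent X p \<longleftrightarrow> p \<in> Arr X \<and> has_pullbacks_along X p \<and>
    (\<exists>R \<eta> \<epsilon>. monadic_adjunction (slice X (Dom X p)) (slice X (Cod X p)) (postcomp X p) R \<eta> \<epsilon>)"

definition preserves_effective_descent ::
  "('o1, 'm1) cat \<Rightarrow> ('o2, 'm2) cat \<Rightarrow> ('o1, 'm1, 'o2, 'm2) func \<Rightarrow> bool"
  where "preserves_effective_descent C D F \<longleftrightarrow>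
    (\<forall>p. effective_descent C p \<longrightarrow> effective_descent D (AMap F p))"

lemma right_adjoint_pullback:
  assumes X: "category X" and p: "p \<in> Hom X a b"
    and adj: "adjunction (slice X a) (slice X b) (postcomp X p) R \<eta> \<epsilon>"
    and f: "f \<in> Obj (slice X b)"
  shows "is_pullback X p f (OMap R f) (fst (snd (\<epsilon> f)))"
proof -
  interpret X: category X by (rule X)
  interpret adjunction "slice X a" "slice X b" "postcomp X p" R \<eta> \<epsilon> by (rule adj)
  have fH: "f \<in> Hom X (Dom X f) b" using f by (simp add: slice_def Hom_def)
  define u where "u = OMap R f"
  define v where "v = fst (snd (\<epsilon> f))"
  have u: "u \<in> Hom X (Dom X u) a"
    using right.omap_obj[OF f] by (simp add: slice_def Hom_def u_def)
  have "\<epsilon> f \<in> Hom (slice X b) (p \<cdot>\<^bsub>X\<^esub> u) f"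
    using counit.component_hom[OF f] by (simp add: comp_func_def id_func_def postcomp_def u_def)
  then have eps: "\<epsilon> f = (p \<cdot>\<^bsub>X\<^esub> u, v, f)" and v0: "v \<in> Hom X (Dom X (p \<cdot>\<^bsub>X\<^esub> u)) (Dom X f)"
    and sq: "f \<cdot>\<^bsub>X\<^esub> v = p \<cdot>\<^bsub>X\<^esub> u"
    by (auto simp: slice_def Hom_def v_def)
  have v: "v \<in> Hom X (Dom X u) (Dom X f)"
    using v0 X.comp_hom[OF u p] by (simp add: Hom_def)
  have "\<exists>!h. h \<in> Hom X z (Dom X u) \<and> u \<cdot>\<^bsub>X\<^esub> h = s \<and> v \<cdot>\<^bsub>X\<^esub> h = t"
    if s: "s \<in> Hom X z a" and t: "t \<in> Hom X z (Dom X f)" and st: "p \<cdot>\<^bsub>X\<^esub> s = f \<cdot>\<^bsub>X\<^esub> t" for z s t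
  proof (rule ex_ex1I)
    have so: "s \<in> Obj (slice X a)" using s by (simp add: slice_def Hom_def)
    define w where "w = OMap R (p \<cdot>\<^bsub>X\<^esub> s)"
    have ps: "p \<cdot>\<^bsub>X\<^esub> s \<in> Hom X z b" using X.comp_hom[OF s p] .
    define T where "T = (p \<cdot>\<^bsub>X\<^esub> s, t, f)"
    have T: "T \<in> Hom (slice X b) (p \<cdot>\<^bsub>X\<^esub> s) f"
      using ps fH t st by (auto simp: slice_def Hom_def T_def)
    have RT: "AMap R T \<in> Hom (slice X a) w u"
      using right.amap_hom[OF T] by (simp add: w_def u_def)
    have et: "\<eta> s \<in> Hom (slice X a) s w"
      using unit.component_hom[OF so] by (simp add: comp_func_def id_func_def postcomp_def w_def)
    define H where "H = AMap R T \<cdot>\<^bsub>slice X a\<^esub> \<eta> s"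
    have H: "H \<in> Hom (slice X a) s u"
      unfolding H_def using left.dom.comp_hom[OF et RT] .
    obtain h where h: "H = (s, h, u)"
      using H by (auto simp: slice_def Hom_def)
    have hh: "h \<in> Hom X z (Dom X u)" "u \<cdot>\<^bsub>X\<^esub> h = s"
      using H h s by (auto simp: slice_def Hom_def)
    let ?P = "postcomp X p"
    have P1: "AMap ?P H = AMap ?P (AMap R T) \<cdot>\<^bsub>slice X b\<^esub> AMap ?P (\<eta> s)"
      unfolding H_def using left.amap_comp[OF et RT] .
    have a1: "AMap ?P (\<eta> s) \<in> Hom (slice X b) (p \<cdot>\<^bsub>X\<^esub> s) (p \<cdot>\<^bsub>X\<^esub> w)"
      using left.amap_hom[OF et] by (simp add: postcomp_def)
    have a2: "AMap ?P (AMap R T) \<in> Hom (slice X b) (p \<cdot>\<^bsub>X\<^esub> w) (p \<cdot>\<^bsub>X\<^esub> u)"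
      using left.amap_hom[OF RT] by (simp add: postcomp_def)
    have a3: "\<epsilon> f \<in> Hom (slice X b) (p \<cdot>\<^bsub>X\<^esub> u) f"
      using \<open>\<epsilon> f \<in> Hom (slice X b) (p \<cdot>\<^bsub>X\<^esub> u) f\<close> .
    have pso: "p \<cdot>\<^bsub>X\<^esub> s \<in> Obj (slice X b)" using ps by (simp add: slice_def Hom_def)
    have a4: "\<epsilon> (p \<cdot>\<^bsub>X\<^esub> s) \<in> Hom (slice X b) (p \<cdot>\<^bsub>X\<^esub> w) (p \<cdot>\<^bsub>X\<^esub> s)"
      using counit.component_hom[OF pso] by (simp add: comp_func_def id_func_def postcomp_def w_def)
    have "\<epsilon> f \<cdot>\<^bsub>slice X b\<^esub> AMap ?P H
        = \<epsilon> f \<cdot>\<^bsub>slice X b\<^esub> AMap ?P (AMap R T) \<cdot>\<^bsub>slice X b\<^esub> AMap ?P (\<eta> s)"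
      unfolding P1 using left.cod.comp_assoc[OF a1 a2 a3] .
    also have "\<epsilon> f \<cdot>\<^bsub>slice X b\<^esub> AMap ?P (AMap R T) = T \<cdot>\<^bsub>slice X b\<^esub> \<epsilon> (p \<cdot>\<^bsub>X\<^esub> s)"
      using counit.naturality[OF T] by (simp add: comp_func_def id_func_def)
    also have "T \<cdot>\<^bsub>slice X b\<^esub> \<epsilon> (p \<cdot>\<^bsub>X\<^esub> s) \<cdot>\<^bsub>slice X b\<^esub> AMap ?P (\<eta> s) =
        T \<cdot>\<^bsub>slice X b\<^esub> (\<epsilon> (p \<cdot>\<^bsub>X\<^esub> s) \<cdot>\<^bsub>slice X b\<^esub> AMap ?P (\<eta> s))"
      using left.cod.comp_assoc[OF a1 a4 T] by simp
    also have "\<dots> = T"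
      using triangle_left[OF so] left.cod.ident_right[OF T] by (simp add: postcomp_def)
    finally have "\<epsilon> f \<cdot>\<^bsub>slice X b\<^esub> AMap ?P H = T" .
    then have "v \<cdot>\<^bsub>X\<^esub> h = t"
      by (simp add: eps h T_def postcomp_def slice_def)
    with hh show "\<exists>h. h \<in> Hom X z (Dom X u) \<and> u \<cdot>\<^bsub>X\<^esub> h = s \<and> v \<cdot>\<^bsub>X\<^esub> h = t"
      by blast
  next
    have so: "s \<in> Obj (slice X a)" using s by (simp add: slice_def Hom_def)
    have ps: "p \<cdot>\<^bsub>X\<^esub> s \<in> Hom X z b" using X.comp_hom[OF s p] .
    let ?P = "postcomp X p"
    have uo: "u \<in> Obj (slice X a)" using u by (simp add: slice_def Hom_def)
    have key: "(s, h, u) = AMap R (p \<cdot>\<^bsub>X\<^esub> s, t, f) \<cdot>\<^bsub>slice X a\<^esub> \<eta> s"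
      if h: "h \<in> Hom X z (Dom X u) \<and> u \<cdot>\<^bsub>X\<^esub> h = s \<and> v \<cdot>\<^bsub>X\<^esub> h = t" for h
    proof -
      have H: "(s, h, u) \<in> Hom (slice X a) s u"
        using h s u by (auto simp: slice_def Hom_def)
      have PH: "AMap ?P (s, h, u) \<in> Hom (slice X b) (p \<cdot>\<^bsub>X\<^esub> s) (p \<cdot>\<^bsub>X\<^esub> u)"
        using left.amap_hom[OF H] by (simp add: postcomp_def)
      have a3: "\<epsilon> f \<in> Hom (slice X b) (p \<cdot>\<^bsub>X\<^esub> u) f"
        using \<open>\<epsilon> f \<in> Hom (slice X b) (p \<cdot>\<^bsub>X\<^esub> u) f\<close> .
      have e: "(p \<cdot>\<^bsub>X\<^esub> s, t, f) = \<epsilon> f \<cdot>\<^bsub>slice X b\<^esub> AMap ?P (s, h, u)"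
        using h by (simp add: eps postcomp_def slice_def)
      have b1: "\<eta> s \<in> Hom (slice X a) s (OMap R (p \<cdot>\<^bsub>X\<^esub> s))"
        using unit.component_hom[OF so] by (simp add: comp_func_def id_func_def postcomp_def)
      have b2: "\<eta> u \<in> Hom (slice X a) u (OMap R (p \<cdot>\<^bsub>X\<^esub> u))"
        using unit.component_hom[OF uo] by (simp add: comp_func_def id_func_def postcomp_def)
      have b3: "AMap R (\<epsilon> f) \<in> Hom (slice X a) (OMap R (p \<cdot>\<^bsub>X\<^esub> u)) u"
        using right.amap_hom[OF a3] by (simp add: u_def)
      have "AMap R (p \<cdot>\<^bsub>X\<^esub> s, t, f) \<cdot>\<^bsub>slice X a\<^esub> \<eta> s
          = AMap R (\<epsilon> f) \<cdot>\<^bsub>slice X a\<^esub> AMap R (AMap ?P (s, h, u)) \<cdot>\<^bsub>slice X a\<^esub> \<eta> s"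
        unfolding e using right.amap_comp[OF PH a3] by simp
      also have "\<dots> = AMap R (\<epsilon> f) \<cdot>\<^bsub>slice X a\<^esub> (AMap R (AMap ?P (s, h, u)) \<cdot>\<^bsub>slice X a\<^esub> \<eta> s)"
        using left.dom.comp_assoc[OF b1 right.amap_hom[OF PH] b3] by simp
      also have "AMap R (AMap ?P (s, h, u)) \<cdot>\<^bsub>slice X a\<^esub> \<eta> s = \<eta> u \<cdot>\<^bsub>slice X a\<^esub> (s, h, u)"
        using unit.naturality[OF H] by (simp add: comp_func_def id_func_def)
      also have "AMap R (\<epsilon> f) \<cdot>\<^bsub>slice X a\<^esub> (\<eta> u \<cdot>\<^bsub>slice X a\<^esub> (s, h, u))
          = AMap R (\<epsilon> f) \<cdot>\<^bsub>slice X a\<^esub> \<eta> u \<cdot>\<^bsub>slice X a\<^esub> (s, h, u)"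
        using left.dom.comp_assoc[OF H b2 b3] .
      also have "\<dots> = (s, h, u)"
        using triangle_right[OF f] left.dom.ident_left[OF H] by (simp add: u_def)
      finally show ?thesis by simp
    qed
    show "h = h'"
      if "h \<in> Hom X z (Dom X u) \<and> u \<cdot>\<^bsub>X\<^esub> h = s \<and> v \<cdot>\<^bsub>X\<^esub> h = t"
        and "h' \<in> Hom X z (Dom X u) \<and> u \<cdot>\<^bsub>X\<^esub> h' = s \<and> v \<cdot>\<^bsub>X\<^esub> h' = t" for h h'
      using key[OF that(1)] key[OF that(2)] by (metis prod.inject)
  qed
  moreover have "Dom X p = a"
    using p by (simp add: Hom_def)
  ultimately have "\<forall>z \<in> Obj X. \<forall>s \<in> Hom X z (Dom X p). \<forall>t \<in> Hom X z (Dom X f).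
      p \<cdot>\<^bsub>X\<^esub> s = f \<cdot>\<^bsub>X\<^esub> t \<longrightarrow>
      (\<exists>!h. h \<in> Hom X z (Dom X u) \<and> u \<cdot>\<^bsub>X\<^esub> h = s \<and> v \<cdot>\<^bsub>X\<^esub> h = t)"
    by blast
  moreover have "p \<in> Arr X" "f \<in> Arr X" "Cod X p = Cod X f" "u \<in> Arr X" "Cod X u = Dom X p"
    "v \<in> Arr X" "Cod X v = Dom X f" "Dom X u = Dom X v" "p \<cdot>\<^bsub>X\<^esub> u = f \<cdot>\<^bsub>X\<^esub> v"
    using p fH u v sq by (simp_all add: Hom_def)
  ultimately show ?thesis
    unfolding is_pullback_def u_def[symmetric] v_def[symmetric] by blast
qed

end

theory Submission
  imports Defs
begin

text \<open>
  A naturality square of \<open>\<epsilon>\<close> at \<open>p : a \<rightarrow> b\<close> is a pullback square that exhibits \<open>L U p\<close> as the pullback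
  of \<open>p\<close> along \<open>\<epsilon> b\<close>. The theorem is therefore an instance of the stability of effective descent
  morphisms under pullback, which holds for the following reason even if pullbacks along \<open>p\<close>
  are the only ones that exist.

  Let \<open>g : c \<rightarrow> b\<close>, and let \<open>q : d \<rightarrow> c\<close> and \<open>u : d \<rightarrow> a\<close> be the projections of a pullback of \<open>g\<close> and
  \<open>p\<close>. By pasting of squares, a pullback of \<open>p\<close> along \<open>g \<cdot> f\<close> is also a pullback of \<open>q\<close> along \<open>f\<close>, so
  all pullbacks along \<open>q\<close> exist, and \<open>q\<^sup>*\<close> can be chosen so that \<open>u\<^sub>! q\<^sup>* = p\<^sup>* g\<^sub>!\<close> holds strictly,
  with the same underlying arrows for unit and counit. Consequently an algebra structure
  (descent datum) on \<open>y : Y \<rightarrow> d\<close> relative to \<open>q\<close> is a descent datum on \<open>u \<cdot> y\<close> relative to \<open>p\<close> for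
  which \<open>y\<close> is equivariant towards \<open>u\<close>, with the canonical datum that \<open>u\<close> has as a pullback of \<open>g\<close>.
  In other words the descent category of \<open>q\<close> is the slice of the descent category of \<open>p\<close> over the
  image of \<open>g\<close>, just as \<open>X \<down> c\<close> is the slice of \<open>X \<down> b\<close> over \<open>g\<close>. An equivalence
  for \<open>p\<close> thus induces one for \<open>q\<close>.

  The equivalences are handled through full faithfulness and essential surjectivity, and these in
  turn are expressed by arrows of the base category alone (\<open>monadic_iff\<close>). The transfer from \<open>p\<close>
  to \<open>q\<close> is then done in \<open>pb_faithful\<close>, \<open>pb_full\<close> and \<open>pb_effective\<close>.
\<close>

section \<open>Categories, functors and adjunctions\<close>

context category
begin

lemma comp_arr [simp]:
  assumes "f \<in> Arr C" "g \<in> Arr C" "Cod C f = Dom C g"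
  shows "g \<cdot> f \<in> Arr C" "Dom C (g \<cdot> f) = Dom C f" "Cod C (g \<cdot> f) = Cod C g"
  using comp_hom[of f "Dom C f" "Dom C g" g "Cod C g"] assms by (auto simp: Hom_def)

lemma ident_arr [simp]:
  assumes "x \<in> Obj C"
  shows "Ident C x \<in> Arr C" "Dom C (Ident C x) = x" "Cod C (Ident C x) = x"
  using ident_hom[OF assms] by (auto simp: Hom_def)

lemma comp_ident [simp]:
  "f \<in> Arr C \<Longrightarrow> Dom C f = x \<Longrightarrow> f \<cdot> Ident C x = f"
  "f \<in> Arr C \<Longrightarrow> Cod C f = x \<Longrightarrow> Ident C x \<cdot> f = f"
  using ident_left ident_right by (auto simp: Hom_def)

lemma arr_obj [simp]: "f \<in> Arr C \<Longrightarrow> Dom C f \<in> Obj C" "f \<in> Arr C \<Longrightarrow> Cod C f \<in> Obj C"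
  by (rule dom_obj cod_obj; assumption)+

lemma assoc:
  assumes "f \<in> Arr C" "g \<in> Arr C" "h \<in> Arr C" "Cod C f = Dom C g" "Cod C g = Dom C h"
  shows "h \<cdot> g \<cdot> f = h \<cdot> (g \<cdot> f)"
  using comp_assoc[of f "Dom C f" "Dom C g" g "Dom C h" h "Cod C h"] assms by (auto simp: Hom_def)

lemma iso_cancel_left:
  assumes "is_iso C t" "f \<in> Hom C x (Dom C t)" "f' \<in> Hom C x (Dom C t)" "t \<cdot> f = t \<cdot> f'"
  shows "f = f'"
proof -
  obtain s where s: "s \<in> Hom C (Cod C t) (Dom C t)" "s \<cdot> t = Ident C (Dom C t)" and t: "t \<in> Arr C"
    using assms(1) by (auto simp: is_iso_def)
  have "s \<cdot> t \<cdot> f = s \<cdot> t \<cdot> f'"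
    using assms s(1) t by (simp add: Hom_def assoc)
  then show ?thesis using assms s by (simp add: Hom_def)
qed

lemma iso_cancel_right:
  assumes "is_iso C t" "f \<in> Hom C (Cod C t) y" "f' \<in> Hom C (Cod C t) y" "f \<cdot> t = f' \<cdot> t"
  shows "f = f'"
proof -
  obtain s where s: "s \<in> Hom C (Cod C t) (Dom C t)" "t \<cdot> s = Ident C (Cod C t)" and t: "t \<in> Arr C"
    using assms(1) by (auto simp: is_iso_def)
  have "f \<cdot> t \<cdot> s = f' \<cdot> t \<cdot> s"
    using assms by simp
  then show ?thesis using assms(2,3) s t by (simp add: Hom_def assoc)
qed

end

lemma (in category) id_functor: "is_functor C C id_func"
  by unfold_locales (simp_all add: id_func_def)

lemma comp_functor:
  assumes "is_functor C D F" "is_functor D E G"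
  shows "is_functor C E (G \<odot> F)"
proof -
  interpret F: is_functor C D F by fact
  interpret G: is_functor D E G by fact
  show ?thesis
  proof (unfold_locales, goal_cases)
    case (4 f x y g z)
    then show ?case
      using F.amap_comp[OF 4] G.amap_comp[OF F.amap_hom[OF 4(1)] F.amap_hom[OF 4(2)]]
      by (simp add: comp_func_def)
  qed (simp_all add: comp_func_def F.omap_obj G.omap_obj F.amap_ident G.amap_ident
      F.amap_hom G.amap_hom)
qed

text \<open>The functoriality of the identity and composite functors is automatic, and the rest of an
  adjunction consists of equations between components.\<close>

lemma adjunctionI:
  assumes L: "is_functor A C L" and U: "is_functor C A U"
    and "\<And>x. x \<in> Obj A \<Longrightarrow> \<eta> x \<in> Hom A x (OMap U (OMap L x))"
    and "\<And>f x y. f \<in> Hom A x y \<Longrightarrow> \<eta> y \<cdot>\<^bsub>A\<^esub> f = AMap U (AMap L f) \<cdot>\<^bsub>A\<^esub> \<eta> x"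
    and "\<And>y. y \<in> Obj C \<Longrightarrow> \<epsilon> y \<in> Hom C (OMap L (OMap U y)) y"
    and "\<And>g y z. g \<in> Hom C y z \<Longrightarrow> \<epsilon> z \<cdot>\<^bsub>C\<^esub> AMap L (AMap U g) = g \<cdot>\<^bsub>C\<^esub> \<epsilon> y"
    and "\<And>x. x \<in> Obj A \<Longrightarrow> \<epsilon> (OMap L x) \<cdot>\<^bsub>C\<^esub> AMap L (\<eta> x) = Ident C (OMap L x)"
    and "\<And>y. y \<in> Obj C \<Longrightarrow> AMap U (\<epsilon> y) \<cdot>\<^bsub>A\<^esub> \<eta> (OMap U y) = Ident A (OMap U y)"
  shows "adjunction A C L U \<eta> \<epsilon>"
proof -
  have A: "category A" and C: "category C" using L unfolding is_functor_def by blast+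
  show ?thesis
    using assms L U comp_functor[OF L U] comp_functor[OF U L]
      category.id_functor[OF A] category.id_functor[OF C]
    by (intro adjunction.intro nat_trans.intro nat_trans_axioms.intro adjunction_axioms.intro)
      (simp_all add: comp_func_def id_func_def)
qed

section \<open>Equivalences\<close>

definition fully_faithful where
  "fully_faithful C D F \<longleftrightarrow> (\<forall>x \<in> Obj C. \<forall>y \<in> Obj C.
    bij_betw (AMap F) (Hom C x y) (Hom D (OMap F x) (OMap F y)))"

definition essentially_surjective where
  "essentially_surjective C D F \<longleftrightarrow>
    (\<forall>d \<in> Obj D. \<exists>x \<in> Obj C. \<exists>t \<in> Hom D (OMap F x) d. is_iso D t)"

text \<open>
  Naturality of the isomorphism \<open>F G \<cong> id\<close> makes \<open>G\<close> faithful. An arrow \<open>k : F x \<rightarrow> F y\<close> is then the image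
  of the conjugate of \<open>G k\<close> by the isomorphism \<open>id \<cong> G F\<close>, because both have the same image under \<open>G\<close>.
\<close>

lemma equivalence_imp_fully_faithful:
  assumes "is_equivalence C D F"
  shows "fully_faithful C D F" "essentially_surjective C D F"
proof -
  obtain G \<sigma> \<tau> where F: "is_functor C D F" and G: "is_functor D C G"
    and \<sigma>: "nat_iso C C id_func (G \<odot> F) \<sigma>" and \<tau>: "nat_iso D D (F \<odot> G) id_func \<tau>"
    using assms by (auto simp: is_equivalence_def)
  interpret F: is_functor C D F by fact
  interpret G: is_functor D C G by fact
  interpret \<sigma>: nat_trans C C id_func "G \<odot> F" \<sigma> using \<sigma> by (simp add: nat_iso_def)
  interpret \<tau>: nat_trans D D "F \<odot> G" id_func \<tau> using \<tau> by (simp add: nat_iso_def)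
  note [simp] = comp_func_def id_func_def
  have \<sigma>h: "\<sigma> x \<in> Hom C x (OMap G (OMap F x))" if "x \<in> Obj C" for x
    using \<sigma>.component_hom[OF that] by simp
  have \<tau>h: "\<tau> x \<in> Hom D (OMap F (OMap G x)) x" if "x \<in> Obj D" for x
    using \<tau>.component_hom[OF that] by simp
  have \<sigma>n: "\<sigma> y \<cdot>\<^bsub>C\<^esub> f = AMap G (AMap F f) \<cdot>\<^bsub>C\<^esub> \<sigma> x" if "f \<in> Hom C x y" for f x y
    using \<sigma>.naturality[OF that] by simp
  have \<tau>n: "\<tau> y \<cdot>\<^bsub>D\<^esub> AMap F (AMap G f) = f \<cdot>\<^bsub>D\<^esub> \<tau> x" if "f \<in> Hom D x y" for f x y
    using \<tau>.naturality[OF that] by simp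
  have \<sigma>i: "is_iso C (\<sigma> x)" if "x \<in> Obj C" for x using \<sigma> that by (auto simp: nat_iso_def)
  have \<tau>i: "is_iso D (\<tau> x)" if "x \<in> Obj D" for x using \<tau> that by (auto simp: nat_iso_def)
  have G_faithful: "k = k'"
    if "k \<in> Hom D x y" "k' \<in> Hom D x y" "AMap G k = AMap G k'" for k k' x y
  proof (rule F.cod.iso_cancel_right)
    have x: "x \<in> Obj D" using that(1) by (auto simp: Hom_def)
    show "is_iso D (\<tau> x)" using \<tau>i x .
    show "k \<in> Hom D (Cod D (\<tau> x)) y" "k' \<in> Hom D (Cod D (\<tau> x)) y"
      using that \<tau>h[OF x] by (auto simp: Hom_def)
    show "k \<cdot>\<^bsub>D\<^esub> \<tau> x = k' \<cdot>\<^bsub>D\<^esub> \<tau> x" using \<tau>n that by metis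
  qed
  show "fully_faithful C D F"
    unfolding fully_faithful_def bij_betw_def
  proof (intro ballI conjI inj_onI equalityI subsetI)
    fix x y f f'
    assume x: "x \<in> Obj C" and y: "y \<in> Obj C" and f: "f \<in> Hom C x y" "f' \<in> Hom C x y"
      and eq: "AMap F f = AMap F f'"
    show "f = f'"
    proof (rule F.dom.iso_cancel_left)
      show "is_iso C (\<sigma> y)" using \<sigma>i y .
      show "f \<in> Hom C x (Dom C (\<sigma> y))" "f' \<in> Hom C x (Dom C (\<sigma> y))"
        using f \<sigma>h[OF y] by (auto simp: Hom_def)
      show "\<sigma> y \<cdot>\<^bsub>C\<^esub> f = \<sigma> y \<cdot>\<^bsub>C\<^esub> f'" using \<sigma>n f eq by metis
    qed
  next
    fix x y k
    assume "k \<in> AMap F ` Hom C x y"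
    then show "k \<in> Hom D (OMap F x) (OMap F y)" using F.amap_hom by auto
  next
    fix x y k
    assume x: "x \<in> Obj C" and y: "y \<in> Obj C" and k: "k \<in> Hom D (OMap F x) (OMap F y)"
    obtain s where s: "s \<in> Hom C (Cod C (\<sigma> y)) (Dom C (\<sigma> y))"
      "\<sigma> y \<cdot>\<^bsub>C\<^esub> s = Ident C (Cod C (\<sigma> y))"
      using \<sigma>i[OF y] by (auto simp: is_iso_def)
    define f where "f = s \<cdot>\<^bsub>C\<^esub> (AMap G k \<cdot>\<^bsub>C\<^esub> \<sigma> x)"
    note h = s(1) \<sigma>h[OF x] \<sigma>h[OF y] G.amap_hom[OF k]
    have f: "f \<in> Hom C x y" using h by (auto simp: f_def Hom_def)
    have "\<sigma> y \<cdot>\<^bsub>C\<^esub> f = \<sigma> y \<cdot>\<^bsub>C\<^esub> s \<cdot>\<^bsub>C\<^esub> (AMap G k \<cdot>\<^bsub>C\<^esub> \<sigma> x)"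
      unfolding f_def using h by (subst F.dom.assoc) (auto simp: Hom_def)
    also have "\<dots> = AMap G k \<cdot>\<^bsub>C\<^esub> \<sigma> x" using h s(2) by (auto simp: Hom_def)
    finally have "AMap G (AMap F f) \<cdot>\<^bsub>C\<^esub> \<sigma> x = AMap G k \<cdot>\<^bsub>C\<^esub> \<sigma> x" using \<sigma>n[OF f] by simp
    then have "AMap G (AMap F f) = AMap G k"
      using F.dom.iso_cancel_right[OF \<sigma>i[OF x]] h G.amap_hom[OF F.amap_hom[OF f]]
      by (auto simp: Hom_def)
    then have "AMap F f = k" using G_faithful[OF F.amap_hom[OF f] k] by simp
    then show "k \<in> AMap F ` Hom C x y" using f by blast
  qed
  show "essentially_surjective C D F"
    unfolding essentially_surjective_def using \<tau>h \<tau>i G.omap_obj by blast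
qed

text \<open>
  A quasi-inverse \<open>G\<close> comes from choosing for each \<open>d\<close> an isomorphism \<open>t d : F (Q d) \<rightarrow> d\<close>. Every arrow
  \<open>F x \<rightarrow> d\<close> factors uniquely as \<open>t d \<cdot> F f\<close>; this determines \<open>G\<close> on arrows and the unit, and turns each
  required equation in \<open>C\<close> into one in \<open>D\<close> that can be tested after \<open>t d\<close>.
\<close>

lemma fully_faithful_imp_equivalence:
  assumes F: "is_functor C D F"
    and ff: "fully_faithful C D F" and es: "essentially_surjective C D F"
  shows "is_equivalence C D F"
proof -
  interpret F: is_functor C D F by (rule F)
  obtain Q t where Q: "\<And>d. d \<in> Obj D \<Longrightarrow> Q d \<in> Obj C"
    and t: "\<And>d. d \<in> Obj D \<Longrightarrow> t d \<in> Hom D (OMap F (Q d)) d"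
    and ti: "\<And>d. d \<in> Obj D \<Longrightarrow> is_iso D (t d)"
    using es unfolding essentially_surjective_def by metis
  have faithful: "f = f'" if "x \<in> Obj C" "y \<in> Obj C" "f \<in> Hom C x y" "f' \<in> Hom C x y"
    "AMap F f = AMap F f'" for f f' x y
    using ff that unfolding fully_faithful_def bij_betw_def by (metis inj_onD)
  have full: "\<exists>f \<in> Hom C x y. AMap F f = k" if "x \<in> Obj C" "y \<in> Obj C"
    "k \<in> Hom D (OMap F x) (OMap F y)" for k x y
  proof -
    have "k \<in> AMap F ` Hom C x y"
      using ff that unfolding fully_faithful_def bij_betw_def by simp
    then show ?thesis by auto
  qed
  have o: "x \<in> Obj D" "y \<in> Obj D" if "k \<in> Hom D x y" for k x y
    using that by (auto simp: Hom_def)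
  have oC: "x \<in> Obj C" "y \<in> Obj C" if "k \<in> Hom C x y" for k x y
    using that by (auto simp: Hom_def)
  have lift: "\<exists>f \<in> Hom C x (Q d). t d \<cdot>\<^bsub>D\<^esub> AMap F f = k"
    if x: "x \<in> Obj C" and k: "k \<in> Hom D (OMap F x) d" for x d k
  proof -
    have d: "d \<in> Obj D" using o[OF k] by simp
    obtain s where s: "s \<in> Hom D d (OMap F (Q d))" "t d \<cdot>\<^bsub>D\<^esub> s = Ident D d"
      using ti[OF d] t[OF d] by (auto simp: is_iso_def Hom_def)
    obtain f where f: "f \<in> Hom C x (Q d)" "AMap F f = s \<cdot>\<^bsub>D\<^esub> k"
      using full[OF x Q[OF d] F.cod.comp_hom[OF k s(1)]] by blast
    have "t d \<cdot>\<^bsub>D\<^esub> AMap F f = t d \<cdot>\<^bsub>D\<^esub> s \<cdot>\<^bsub>D\<^esub> k"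
      unfolding f(2) using F.cod.comp_assoc[OF k s(1) t[OF d]] .
    then show ?thesis using f(1) s(2) F.cod.ident_left[OF k] by auto
  qed
  have unique: "f = f'" if "d \<in> Obj D" "f \<in> Hom C x (Q d)" "f' \<in> Hom C x (Q d)"
    "t d \<cdot>\<^bsub>D\<^esub> AMap F f = t d \<cdot>\<^bsub>D\<^esub> AMap F f'" for f f' x d
  proof (rule faithful[OF _ Q[OF that(1)] that(2,3)])
    show "x \<in> Obj C" using oC that by blast
    show "AMap F f = AMap F f'"
      using F.cod.iso_cancel_left[OF ti[OF that(1)] _ _ that(4)] t[OF that(1)]
        F.amap_hom[OF that(2)] F.amap_hom[OF that(3)] by (auto simp: Hom_def)
  qed
  define G where "G = \<lparr>OMap = Q, AMap = (\<lambda>k. SOME f. f \<in> Hom C (Q (Dom D k)) (Q (Cod D k)) \<and>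
    t (Cod D k) \<cdot>\<^bsub>D\<^esub> AMap F f = k \<cdot>\<^bsub>D\<^esub> t (Dom D k))\<rparr>"
  have GO: "OMap G = Q" by (simp add: G_def)
  have GA: "AMap G k \<in> Hom C (Q x) (Q y) \<and> t y \<cdot>\<^bsub>D\<^esub> AMap F (AMap G k) = k \<cdot>\<^bsub>D\<^esub> t x"
    if k: "k \<in> Hom D x y" for k x y
  proof -
    have xy: "Dom D k = x" "Cod D k = y" using k by (auto simp: Hom_def)
    show ?thesis
      unfolding G_def xy func.simps
      using someI_ex[OF lift[OF Q[OF o(1)[OF k]] F.cod.comp_hom[OF t[OF o(1)[OF k]] k],
        unfolded Bex_def]] .
  qed
  note GAh = conjunct1[OF GA] and GAt = conjunct2[OF GA]
  have G: "is_functor D C G"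
  proof (unfold_locales, goal_cases)
    case (1 x)
    then show ?case by (simp add: GO Q)
  next
    case (2 f x y)
    then show ?case using GAh by (simp add: GO)
  next
    case (3 x)
    show ?case unfolding GO
    proof (rule unique[OF 3 GAh[OF F.cod.ident_hom[OF 3]] F.dom.ident_hom[OF Q[OF 3]]])
      show "t x \<cdot>\<^bsub>D\<^esub> AMap F (AMap G (Ident D x)) = t x \<cdot>\<^bsub>D\<^esub> AMap F (Ident C (Q x))"
        using GAt[OF F.cod.ident_hom[OF 3]] F.amap_ident[OF Q[OF 3]] t[OF 3] F.cod.ident_left
          F.cod.ident_right by metis
    qed
  next
    case (4 f x y g z)
    have z: "z \<in> Obj D" using o 4 by blast
    note h = GAh[OF 4(1)] GAh[OF 4(2)]
    show ?case
    proof (rule unique[OF z GAh[OF F.cod.comp_hom[OF 4]] F.dom.comp_hom[OF h]])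
      have "t z \<cdot>\<^bsub>D\<^esub> AMap F (AMap G (g \<cdot>\<^bsub>D\<^esub> f)) = g \<cdot>\<^bsub>D\<^esub> (f \<cdot>\<^bsub>D\<^esub> t x)"
        using GAt[OF F.cod.comp_hom[OF 4]] F.cod.comp_assoc[OF t[OF o(1)[OF 4(1)]] 4] by simp
      also have "\<dots> = g \<cdot>\<^bsub>D\<^esub> t y \<cdot>\<^bsub>D\<^esub> AMap F (AMap G f)"
        using GAt[OF 4(1)] F.cod.comp_assoc[OF F.amap_hom[OF h(1)] t[OF o(2)[OF 4(1)]] 4(2)] by simp
      also have "\<dots> = t z \<cdot>\<^bsub>D\<^esub> (AMap F (AMap G g) \<cdot>\<^bsub>D\<^esub> AMap F (AMap G f))"
        using GAt[OF 4(2)] F.cod.comp_assoc[OF F.amap_hom[OF h(1)] F.amap_hom[OF h(2)] t[OF z]]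
        by simp
      finally show "t z \<cdot>\<^bsub>D\<^esub> AMap F (AMap G (g \<cdot>\<^bsub>D\<^esub> f)) =
          t z \<cdot>\<^bsub>D\<^esub> AMap F (AMap G g \<cdot>\<^bsub>C\<^esub> AMap G f)"
        using F.amap_comp[OF h] by simp
    qed
  qed
  interpret G: is_functor D C G by (rule G)
  note [simp] = comp_func_def id_func_def
  have "\<exists>f. x \<in> Obj C \<longrightarrow> f \<in> Hom C x (Q (OMap F x)) \<and>
      t (OMap F x) \<cdot>\<^bsub>D\<^esub> AMap F f = Ident D (OMap F x)" for x
    using lift[OF _ F.cod.ident_hom[OF F.omap_obj]] by blast
  then obtain \<sigma> where \<sigma>: "\<And>x. x \<in> Obj C \<Longrightarrow> \<sigma> x \<in> Hom C x (Q (OMap F x))"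
    and t\<sigma>: "\<And>x. x \<in> Obj C \<Longrightarrow> t (OMap F x) \<cdot>\<^bsub>D\<^esub> AMap F (\<sigma> x) = Ident D (OMap F x)"
    by metis
  have "nat_iso C C id_func (G \<odot> F) \<sigma>"
    unfolding nat_iso_def
  proof (intro conjI ballI)
    show "nat_trans C C id_func (G \<odot> F) \<sigma>"
    proof (unfold_locales, goal_cases)
      case (9 x)
      then show ?case using \<sigma> by (simp add: GO)
    next
      case (10 f x y)
      note x = oC(1)[OF 10] and y = oC(2)[OF 10] and Ff = F.amap_hom[OF 10]
      note GFf = GAh[OF Ff]
      have "\<sigma> y \<cdot>\<^bsub>C\<^esub> f = AMap G (AMap F f) \<cdot>\<^bsub>C\<^esub> \<sigma> x"
      proof (rule unique[OF F.omap_obj[OF y] F.dom.comp_hom[OF 10 \<sigma>[OF y]]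
            F.dom.comp_hom[OF \<sigma>[OF x] GFf]])
        have "t (OMap F y) \<cdot>\<^bsub>D\<^esub> (AMap F (\<sigma> y) \<cdot>\<^bsub>D\<^esub> AMap F f) = AMap F f"
          using F.cod.comp_assoc[OF Ff F.amap_hom[OF \<sigma>[OF y]] t[OF F.omap_obj[OF y]]] t\<sigma>[OF y]
            F.cod.ident_left[OF Ff] by simp
        moreover have "t (OMap F y) \<cdot>\<^bsub>D\<^esub> (AMap F (AMap G (AMap F f)) \<cdot>\<^bsub>D\<^esub> AMap F (\<sigma> x)) = AMap F f"
          using F.cod.comp_assoc[OF F.amap_hom[OF \<sigma>[OF x]] F.amap_hom[OF GFf]
              t[OF F.omap_obj[OF y]]] GAt[OF Ff] t\<sigma>[OF x] F.cod.ident_right[OF Ff]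
            F.cod.comp_assoc[OF F.amap_hom[OF \<sigma>[OF x]] t[OF F.omap_obj[OF x]] Ff] by simp
        ultimately show "t (OMap F y) \<cdot>\<^bsub>D\<^esub> AMap F (\<sigma> y \<cdot>\<^bsub>C\<^esub> f) =
            t (OMap F y) \<cdot>\<^bsub>D\<^esub> AMap F (AMap G (AMap F f) \<cdot>\<^bsub>C\<^esub> \<sigma> x)"
          using F.amap_comp[OF 10 \<sigma>[OF y]] F.amap_comp[OF \<sigma>[OF x] GFf] by simp
      qed
      then show ?case by simp
    qed (auto simp: GO Q F.omap_obj F.amap_ident G.amap_ident[unfolded GO] F.amap_comp
        intro!: GAh F.amap_hom G.amap_comp)
  next
    fix x assume x: "x \<in> Obj C"
    note Fx = F.omap_obj[OF x]
    obtain j where j: "j \<in> Hom C (Q (OMap F x)) x" "AMap F j = t (OMap F x)"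
      using full[OF Q[OF Fx] x t[OF Fx]] by blast
    note Fs = F.amap_hom[OF \<sigma>[OF x]] and Fj = F.amap_hom[OF j(1)]
    have "j \<cdot>\<^bsub>C\<^esub> \<sigma> x = Ident C x"
      by (rule faithful[OF x x F.dom.comp_hom[OF \<sigma>[OF x] j(1)] F.dom.ident_hom[OF x]])
        (simp add: F.amap_comp[OF \<sigma>[OF x] j(1)] j(2) t\<sigma> x F.amap_ident)
    moreover have "\<sigma> x \<cdot>\<^bsub>C\<^esub> j = Ident C (Q (OMap F x))"
    proof (rule unique[OF Fx F.dom.comp_hom[OF j(1) \<sigma>[OF x]] F.dom.ident_hom[OF Q[OF Fx]]])
      show "t (OMap F x) \<cdot>\<^bsub>D\<^esub> AMap F (\<sigma> x \<cdot>\<^bsub>C\<^esub> j) =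
          t (OMap F x) \<cdot>\<^bsub>D\<^esub> AMap F (Ident C (Q (OMap F x)))"
        using F.cod.comp_assoc[OF Fj Fs t[OF Fx]] t\<sigma>[OF x] F.cod.ident_left[OF t[OF Fx]]
          F.cod.ident_right[OF t[OF Fx]]
        by (simp add: F.amap_comp[OF j(1) \<sigma>[OF x]] F.amap_ident Q Fx j(2))
    qed
    ultimately show "is_iso C (\<sigma> x)"
      using \<sigma>[OF x] j(1) by (auto simp: is_iso_def Hom_def)
  qed
  moreover have "nat_iso D D (F \<odot> G) id_func t"
    unfolding nat_iso_def
  proof (intro conjI ballI)
    show "nat_trans D D (F \<odot> G) id_func t"
    proof (unfold_locales, goal_cases)
      case (9 x)
      then show ?case using t by (simp add: GO)
    next
      case (10 f x y)
      then show ?case using GAt by simp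
    qed (auto simp: GO Q F.omap_obj F.amap_ident G.amap_ident[unfolded GO] 
        F.amap_comp[OF G.amap_hom G.amap_hom] G.amap_comp intro!: F.amap_hom GAh)
  qed (rule ti)
  ultimately show ?thesis
    using F G unfolding is_equivalence_def by blast
qed

section \<open>Eilenberg-Moore categories and comparison functors\<close>

lemma eilenberg_moore_simps:
  "Dom (eilenberg_moore X T) (\<alpha>, f, \<beta>) = \<alpha>" "Cod (eilenberg_moore X T) (\<alpha>, f, \<beta>) = \<beta>"
  "\<alpha> \<in> Obj (eilenberg_moore X T) \<longleftrightarrow> is_algebra X T \<alpha>"
  by (simp_all add: eilenberg_moore_def)

lemma eilenberg_moore_homE:
  assumes "t \<in> Hom (eilenberg_moore X T) \<alpha> \<beta>"
  obtains f where "t = (\<alpha>, f, \<beta>)" "(\<alpha>, f, \<beta>) \<in> Arr (eilenberg_moore X T)"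
proof -
  obtain \<alpha>' f \<beta>' where t: "t = (\<alpha>', f, \<beta>')" by (metis surj_pair)
  show thesis
    using assms that[of f] unfolding t Hom_def mem_Collect_eq eilenberg_moore_simps by blast
qed

context monad
begin

lemma eilenberg_moore_category: "category (eilenberg_moore X T)"
proof -
  have o: "x \<in> Obj X" "h \<in> Hom X (OMap (Func T) x) x" if "is_algebra X T (x, h)" for x h
    using that by (auto simp: is_algebra_def)
  show ?thesis
  proof (unfold_locales, goal_cases)
    case (4 f x y g z)
    obtain xa xh ya yh za zh where xyz: "x = (xa, xh)" "y = (ya, yh)" "z = (za, zh)"
      by (metis surj_pair)
    obtain f0 where f: "f = (x, f0, y)" "f0 \<in> Hom X xa ya"
      "f0 \<cdot>\<^bsub>X\<^esub> xh = yh \<cdot>\<^bsub>X\<^esub> AMap (Func T) f0" "is_algebra X T x" "is_algebra X T y"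
      using 4(1) by (auto simp: Hom_def eilenberg_moore_def xyz)
    obtain g0 where g: "g = (y, g0, z)" "g0 \<in> Hom X ya za"
      "g0 \<cdot>\<^bsub>X\<^esub> yh = zh \<cdot>\<^bsub>X\<^esub> AMap (Func T) g0" "is_algebra X T z"
      using 4(2) by (auto simp: Hom_def eilenberg_moore_def xyz)
    note hx = o[OF f(4)[unfolded xyz]] and hy = o[OF f(5)[unfolded xyz]]
      and hz = o[OF g(4)[unfolded xyz]]
    note Ff = unit.target.amap_hom[OF f(2)] and Fg = unit.target.amap_hom[OF g(2)]
    have "g0 \<cdot>\<^bsub>X\<^esub> f0 \<cdot>\<^bsub>X\<^esub> xh = g0 \<cdot>\<^bsub>X\<^esub> yh \<cdot>\<^bsub>X\<^esub> AMap (Func T) f0"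
      using unit.source.dom.comp_assoc[OF hx(2) f(2) g(2)] unit.source.dom.comp_assoc[OF Ff hy(2) g(2)] f(3) by simp
    also have "\<dots> = zh \<cdot>\<^bsub>X\<^esub> AMap (Func T) (g0 \<cdot>\<^bsub>X\<^esub> f0)"
      using unit.source.dom.comp_assoc[OF Ff Fg hz(2)] g(3) unit.target.amap_comp[OF f(2) g(2)] by simp
    finally show ?case
      using unit.source.dom.comp_hom[OF f(2) g(2)] f g by (simp add: Hom_def eilenberg_moore_def xyz)
  next
    case (7 f w x g y h z)
    then show ?case
      by (auto simp: Hom_def eilenberg_moore_def is_algebra_def unit.source.dom.assoc)
  qed (auto simp: Hom_def eilenberg_moore_def is_algebra_def unit.target.amap_ident)
qed

text \<open>The inverse of an isomorphism that commutes with the algebra structures commutes with them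
  as well.\<close>

lemma eilenberg_moore_iso_iff:
  "is_iso (eilenberg_moore X T) (\<alpha>, f, \<beta>) \<longleftrightarrow>
    (\<alpha>, f, \<beta>) \<in> Arr (eilenberg_moore X T) \<and> is_iso X f"
proof
  assume "is_iso (eilenberg_moore X T) (\<alpha>, f, \<beta>)"
  then show "(\<alpha>, f, \<beta>) \<in> Arr (eilenberg_moore X T) \<and> is_iso X f"
    by (auto simp: is_iso_def eilenberg_moore_def Hom_def)
next
  assume *: "(\<alpha>, f, \<beta>) \<in> Arr (eilenberg_moore X T) \<and> is_iso X f"
  obtain x \<theta> y \<zeta> where ab: "\<alpha> = (x, \<theta>)" "\<beta> = (y, \<zeta>)" by (metis surj_pair)
  have f: "f \<in> Hom X x y" and eq: "f \<cdot>\<^bsub>X\<^esub> \<theta> = \<zeta> \<cdot>\<^bsub>X\<^esub> AMap (Func T) f"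
    and th: "\<theta> \<in> Hom X (OMap (Func T) x) x" "\<zeta> \<in> Hom X (OMap (Func T) y) y" "x \<in> Obj X" "y \<in> Obj X"
    and alg: "is_algebra X T \<alpha>" "is_algebra X T \<beta>"
    using * by (auto simp: eilenberg_moore_def ab is_algebra_def)
  obtain g where g: "g \<in> Hom X y x" "g \<cdot>\<^bsub>X\<^esub> f = Ident X x" "f \<cdot>\<^bsub>X\<^esub> g = Ident X y"
    using * f by (auto simp: is_iso_def Hom_def)
  note Ff = unit.target.amap_hom[OF f] and Fg = unit.target.amap_hom[OF g(1)]
  have "g \<cdot>\<^bsub>X\<^esub> \<zeta> = g \<cdot>\<^bsub>X\<^esub> \<zeta> \<cdot>\<^bsub>X\<^esub> (AMap (Func T) f \<cdot>\<^bsub>X\<^esub> AMap (Func T) g)"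
    using th g unit.target.amap_comp[OF g(1) f, symmetric]
    by (simp add: Hom_def unit.target.amap_ident unit.target.omap_obj)
  also have "\<dots> = g \<cdot>\<^bsub>X\<^esub> (\<zeta> \<cdot>\<^bsub>X\<^esub> AMap (Func T) f) \<cdot>\<^bsub>X\<^esub> AMap (Func T) g"
    using th g(1) Ff Fg by (simp add: Hom_def unit.source.dom.assoc)
  also have "\<dots> = g \<cdot>\<^bsub>X\<^esub> f \<cdot>\<^bsub>X\<^esub> (\<theta> \<cdot>\<^bsub>X\<^esub> AMap (Func T) g)"
    unfolding eq[symmetric] using th g(1) f Fg by (simp add: Hom_def unit.source.dom.assoc)
  also have "\<dots> = \<theta> \<cdot>\<^bsub>X\<^esub> AMap (Func T) g"
    using th g Fg by (simp add: Hom_def)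
  finally have "(\<beta>, g, \<alpha>) \<in> Arr (eilenberg_moore X T)"
    using g(1) alg by (simp add: eilenberg_moore_def ab)
  then have "(\<beta>, g, \<alpha>) \<in> Hom (eilenberg_moore X T) \<beta> \<alpha>"
    by (simp add: Hom_def eilenberg_moore_def)
  then show "is_iso (eilenberg_moore X T) (\<alpha>, f, \<beta>)"
    unfolding is_iso_def using * g
    by (intro conjI bexI[of _ "(\<beta>, g, \<alpha>)"]) (auto simp: eilenberg_moore_def ab)
qed

end

context adjunction
begin

lemma counit_hom: "y \<in> Obj C \<Longrightarrow> \<epsilon> y \<in> Hom C (OMap L (OMap U y)) y"
  using counit.component_hom by (simp add: comp_func_def id_func_def)

lemma counit_natural: "g \<in> Hom C y z \<Longrightarrow> \<epsilon> z \<cdot>\<^bsub>C\<^esub> AMap L (AMap U g) = g \<cdot>\<^bsub>C\<^esub> \<epsilon> y"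
  using counit.naturality by (simp add: comp_func_def id_func_def)

lemma unit_hom: "x \<in> Obj A \<Longrightarrow> \<eta> x \<in> Hom A x (OMap U (OMap L x))"
  using unit.component_hom by (simp add: comp_func_def id_func_def)

lemma unit_natural: "f \<in> Hom A x y \<Longrightarrow> \<eta> y \<cdot>\<^bsub>A\<^esub> f = AMap U (AMap L f) \<cdot>\<^bsub>A\<^esub> \<eta> x"
  using unit.naturality by (simp add: comp_func_def id_func_def)

lemma comparison_algebra:
  assumes y: "y \<in> Obj C"
  shows "is_algebra A (induced_monad L U \<eta> \<epsilon>) (OMap U y, AMap U (\<epsilon> y))"
proof -
  note e = counit_hom[OF y]
  have e2: "\<epsilon> (OMap L (OMap U y)) \<in> Hom C (OMap L (OMap U (OMap L (OMap U y)))) (OMap L (OMap U y))"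
    using counit_hom y by (simp add: left.omap_obj right.omap_obj)
  show ?thesis
    using triangle_right[OF y] right.amap_hom[OF e] counit_natural[OF e]
      right.amap_comp[OF left.amap_hom[OF right.amap_hom[OF e]] e] right.amap_comp[OF e2 e] y
    by (simp add: is_algebra_def induced_monad_def comp_func_def right.omap_obj)
qed

lemma comparison_functor:
  "is_functor C (eilenberg_moore A (induced_monad L U \<eta> \<epsilon>)) (comparison C U \<epsilon>)"
proof -
  interpret m: monad A "induced_monad L U \<eta> \<epsilon>"
    by (rule induced_monad_is_monad[OF adjunction_axioms])
  interpret EM: category "eilenberg_moore A (induced_monad L U \<eta> \<epsilon>)"
    by (rule m.eilenberg_moore_category)
  have hom: "AMap U f \<cdot>\<^bsub>A\<^esub> AMap U (\<epsilon> x) = AMap U (\<epsilon> y) \<cdot>\<^bsub>A\<^esub> AMap U (AMap L (AMap U f))"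
    if f: "f \<in> Hom C x y" for f x y
  proof -
    have xy: "x \<in> Obj C" "y \<in> Obj C" using f by (auto simp: Hom_def)
    show ?thesis
      using right.amap_comp[OF counit_hom[OF xy(1)] f] counit_natural[OF f]
        right.amap_comp[OF left.amap_hom[OF right.amap_hom[OF f]] counit_hom[OF xy(2)]] by simp
  qed
  show ?thesis
  proof (unfold_locales, goal_cases)
    case (1 x)
    then show ?case using comparison_algebra by (simp add: comparison_def eilenberg_moore_def)
  next
    case (2 f x y)
    then have "x \<in> Obj C" "y \<in> Obj C" "Dom C f = x" "Cod C f = y" by (auto simp: Hom_def)
    then show ?case
      using hom[OF 2] right.amap_hom[OF 2] comparison_algebra
      by (simp add: comparison_def eilenberg_moore_def Hom_def induced_monad_def comp_func_def)
  next
    case (3 x)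
    then show ?case by (simp add: comparison_def eilenberg_moore_def right.amap_ident)
  next
    case (4 f x y g z)
    then have "Dom C f = x" "Cod C f = y" "Dom C g = y" "Cod C g = z" "f \<in> Arr C" "g \<in> Arr C"
      by (auto simp: Hom_def)
    then show ?case
      using right.amap_comp[OF 4] by (simp add: comparison_def eilenberg_moore_def)
  qed
qed

end

section \<open>Slice categories\<close>

lemma slice_obj [simp]: "f \<in> Obj (slice X b) \<longleftrightarrow> f \<in> Arr X \<and> Cod X f = b"
  by (simp add: slice_def)

lemma slice_arr [simp]:
  "(f, h, g) \<in> Arr (slice X b) \<longleftrightarrow> f \<in> Arr X \<and> Cod X f = b \<and> g \<in> Arr X \<and> Cod X g = b \<and>
    h \<in> Arr X \<and> Dom X h = Dom X f \<and> Cod X h = Dom X g \<and> g \<cdot>\<^bsub>X\<^esub> h = f"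
  by (auto simp: slice_def Hom_def)

lemma slice_simps [simp]:
  "Dom (slice X b) (f, h, g) = f" "Cod (slice X b) (f, h, g) = g"
  "Ident (slice X b) f = (f, Ident X (Dom X f), f)"
  "(g', k, g'') \<cdot>\<^bsub>slice X b\<^esub> (f, h, g) = (f, k \<cdot>\<^bsub>X\<^esub> h, g'')"
  by (simp_all add: slice_def)

lemma slice_hom_iff [simp]:
  "(f, h, g) \<in> Hom (slice X b) f' g' \<longleftrightarrow> (f, h, g) \<in> Arr (slice X b) \<and> f' = f \<and> g' = g"
  by (auto simp: Hom_def)

lemma slice_homE:
  assumes "t \<in> Hom (slice X b) f g"
  obtains h where "t = (f, h, g)" "(f, h, g) \<in> Arr (slice X b)"
  using assms by (cases t) (auto simp: Hom_def)

lemma postcomp_simps [simp]: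
  "OMap (postcomp X p) f = p \<cdot>\<^bsub>X\<^esub> f"
  "AMap (postcomp X p) (f, h, g) = (p \<cdot>\<^bsub>X\<^esub> f, h, p \<cdot>\<^bsub>X\<^esub> g)"
  by (simp_all add: postcomp_def)

context category
begin

lemma slice_category: "category (slice C b)"
proof (unfold_locales, goal_cases)
  case (1 f)
  then show ?case by (cases f) simp
next
  case (2 f)
  then show ?case by (cases f) simp
next
  case (3 x)
  then show ?case by simp
next
  case (4 f x y g z)
  obtain h where f: "f = (x, h, y)" and h: "(x, h, y) \<in> Arr (slice C b)"
    using 4(1) by (rule slice_homE)
  obtain k where g: "g = (y, k, z)" and k: "(y, k, z) \<in> Arr (slice C b)"
    using 4(2) by (rule slice_homE)
  have "z \<cdot> (k \<cdot> h) = x" using h k assoc[of h k z] by simp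
  then show ?case using h k by (simp add: f g)
next
  case (5 f x y)
  then show ?case by (rule slice_homE) simp
next
  case (6 f x y)
  then show ?case by (rule slice_homE) simp
next
  case (7 f w x g y h z)
  obtain f0 where f: "f = (w, f0, x)" "(w, f0, x) \<in> Arr (slice C b)"
    using 7(1) by (rule slice_homE)
  obtain g0 where g: "g = (x, g0, y)" "(x, g0, y) \<in> Arr (slice C b)"
    using 7(2) by (rule slice_homE)
  obtain h0 where h: "h = (y, h0, z)" "(y, h0, z) \<in> Arr (slice C b)"
    using 7(3) by (rule slice_homE)
  show ?case using f(2) g(2) h(2) assoc[of f0 g0 h0] by (simp add: f(1) g(1) h(1))
qed

lemma postcomp_functor:
  assumes p: "p \<in> Arr C"
  shows "is_functor (slice C (Dom C p)) (slice C (Cod C p)) (postcomp C p)"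
proof -
  interpret a: category "slice C (Dom C p)" by (rule slice_category)
  interpret b: category "slice C (Cod C p)" by (rule slice_category)
  show ?thesis
  proof (unfold_locales, goal_cases)
    case (1 x)
    then show ?case using p by simp
  next
    case (2 f x y)
    obtain h where "f = (x, h, y)" "(x, h, y) \<in> Arr (slice C (Dom C p))"
      using 2 by (rule slice_homE)
    then show ?case using p assoc[of h y p] by simp
  next
    case (3 x)
    then show ?case using p by simp
  next
    case (4 f x y g z)
    obtain h where "f = (x, h, y)" using 4(1) by (rule slice_homE)
    moreover obtain k where "g = (y, k, z)" using 4(2) by (rule slice_homE)
    ultimately show ?case by simp
  qed
qed

lemma slice_iso_iff:
  "is_iso (slice C b) (f, h, g) \<longleftrightarrow> (f, h, g) \<in> Arr (slice C b) \<and> is_iso C h"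
proof
  assume i: "is_iso (slice C b) (f, h, g)"
  then obtain t where "(f, h, g) \<in> Arr (slice C b)" and t: "t \<in> Hom (slice C b) g f"
    "t \<cdot>\<^bsub>slice C b\<^esub> (f, h, g) = Ident (slice C b) f"
    "(f, h, g) \<cdot>\<^bsub>slice C b\<^esub> t = Ident (slice C b) g"
    by (auto simp only: is_iso_def slice_simps)
  moreover obtain k where "t = (g, k, f)" "(g, k, f) \<in> Arr (slice C b)"
    using t(1) by (rule slice_homE)
  ultimately show "(f, h, g) \<in> Arr (slice C b) \<and> is_iso C h"
    unfolding is_iso_def by (intro conjI bexI[of _ k]) (simp_all add: Hom_def)
next
  assume *: "(f, h, g) \<in> Arr (slice C b) \<and> is_iso C h"
  then obtain k where k: "k \<in> Hom C (Cod C h) (Dom C h)"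
    "k \<cdot> h = Ident C (Dom C h)" "h \<cdot> k = Ident C (Cod C h)"
    by (auto simp only: is_iso_def)
  have "f \<cdot> k = g" using * k assoc[of k h g] by (simp add: Hom_def)
  then have "(g, k, f) \<in> Hom (slice C b) g f" using * k by (simp add: Hom_def)
  then show "is_iso (slice C b) (f, h, g)"
    unfolding is_iso_def using * k by (intro conjI bexI[of _ "(g, k, f)"]) simp_all
qed

end

section \<open>Pullback functors on slices, in terms of arrows of the base\<close>

locale pullback_adjunction =
  base: category X + adjunction "slice X (Dom X p)" "slice X (Cod X p)" "postcomp X p" R \<eta> \<epsilon>
  for X :: "('o, 'm) cat" and p :: 'm and R \<eta> \<epsilon> +
  assumes p [simp]: "p \<in> Arr X"
begin

text \<open>
  For \<open>z\<close> over the codomain of \<open>p\<close>, the arrows \<open>P z\<close> and \<open>E z\<close> are the projections of the pullback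
  of \<open>p\<close> and \<open>z\<close> that \<open>R\<close> selects, and \<open>M z h z'\<close> is the arrow that \<open>h : z \<rightarrow> z'\<close> induces between two of
  them. For \<open>y\<close> over the domain of \<open>p\<close>, the arrow \<open>N y\<close> into the pullback of \<open>p\<close> and \<open>p \<cdot> y\<close> has the
  components \<open>y\<close> and the identity.
\<close>

definition "P z = OMap R z"
definition "E z = fst (snd (\<epsilon> z))"
definition "M z h z' = fst (snd (AMap R (z, h, z')))"
definition "N y = fst (snd (\<eta> y))"

abbreviation over_dom where "over_dom y \<equiv> y \<in> Arr X \<and> Cod X y = Dom X p"
abbreviation over_cod where "over_cod z \<equiv> z \<in> Arr X \<and> Cod X z = Cod X p"

lemma P_over [simp]:
  assumes "over_cod z"
  shows "P z \<in> Arr X" "Cod X (P z) = Dom X p"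
  using right.omap_obj[of z] assms by (auto simp: P_def)

lemma counit_eq: "over_cod z \<Longrightarrow> \<epsilon> z = (p \<cdot>\<^bsub>X\<^esub> P z, E z, z)"
  using counit_hom[of z] unfolding E_def by (auto elim!: slice_homE simp: P_def)

lemma E_arr [simp]:
  assumes "over_cod z"
  shows "E z \<in> Arr X" "Dom X (E z) = Dom X (P z)" "Cod X (E z) = Dom X z"
    "z \<cdot>\<^bsub>X\<^esub> E z = p \<cdot>\<^bsub>X\<^esub> P z"
proof -
  have "(p \<cdot>\<^bsub>X\<^esub> P z, E z, z) \<in> Hom (slice X (Cod X p)) (p \<cdot>\<^bsub>X\<^esub> P z) z"
    using counit_hom[of z] assms counit_eq[OF assms] by (simp add: P_def)
  then show "E z \<in> Arr X" "Dom X (E z) = Dom X (P z)" "Cod X (E z) = Dom X z"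
    "z \<cdot>\<^bsub>X\<^esub> E z = p \<cdot>\<^bsub>X\<^esub> P z"
    using assms by simp_all
qed

lemma right_amap_eq:
  assumes "(z, h, z') \<in> Arr (slice X (Cod X p))"
  shows "AMap R (z, h, z') = (P z, M z h z', P z')"
  using right.amap_hom[of "(z, h, z')" z z'] assms unfolding M_def P_def
  by (auto elim!: slice_homE)

lemma M_arr [simp]:
  assumes "(z, h, z') \<in> Arr (slice X (Cod X p))"
  shows "M z h z' \<in> Arr X" "Dom X (M z h z') = Dom X (P z)" "Cod X (M z h z') = Dom X (P z')"
    "P z' \<cdot>\<^bsub>X\<^esub> M z h z' = P z"
  using right.amap_hom[of "(z, h, z')" z z'] assms unfolding right_amap_eq[OF assms]
  by simp_all

lemma E_natural:
  assumes "(z, h, z') \<in> Arr (slice X (Cod X p))"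
  shows "E z' \<cdot>\<^bsub>X\<^esub> M z h z' = h \<cdot>\<^bsub>X\<^esub> E z"
  using counit_natural[of "(z, h, z')" z z'] assms unfolding right_amap_eq[OF assms]
  by (simp add: counit_eq)

lemma M_comp:
  assumes "(z, h, z') \<in> Arr (slice X (Cod X p))" "(z', k, z'') \<in> Arr (slice X (Cod X p))"
  shows "M z (k \<cdot>\<^bsub>X\<^esub> h) z'' = M z' k z'' \<cdot>\<^bsub>X\<^esub> M z h z'"
proof -
  have *: "(z, k \<cdot>\<^bsub>X\<^esub> h, z'') \<in> Arr (slice X (Cod X p))"
    using left.cod.comp_hom[of "(z, h, z')" z z' "(z', k, z'')" z''] assms by simp
  show ?thesis
    using right.amap_comp[of "(z, h, z')" z z' "(z', k, z'')" z''] assms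
      right_amap_eq[OF assms(1)] right_amap_eq[OF assms(2)] right_amap_eq[OF *] by simp
qed

lemma M_ident:
  assumes "over_cod z"
  shows "M z (Ident X (Dom X z)) z = Ident X (Dom X (P z))"
  using right.amap_ident[of z] right_amap_eq[of z "Ident X (Dom X z)" z] assms
  by (simp add: P_def[symmetric])

lemma unit_eq: "over_dom y \<Longrightarrow> \<eta> y = (y, N y, P (p \<cdot>\<^bsub>X\<^esub> y))"
  using unit_hom[of y] unfolding N_def by (auto elim!: slice_homE simp: P_def)

lemma N_arr [simp]:
  assumes "over_dom y"
  shows "N y \<in> Arr X" "Dom X (N y) = Dom X y" "Cod X (N y) = Dom X (P (p \<cdot>\<^bsub>X\<^esub> y))"
    "P (p \<cdot>\<^bsub>X\<^esub> y) \<cdot>\<^bsub>X\<^esub> N y = y"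
  using unit_hom[of y] assms unfolding unit_eq[OF assms] by (simp_all add: P_def[symmetric])

lemma E_N:
  assumes "over_dom y"
  shows "E (p \<cdot>\<^bsub>X\<^esub> y) \<cdot>\<^bsub>X\<^esub> N y = Ident X (Dom X y)"
  using triangle_left[of y] assms by (simp add: unit_eq counit_eq)

lemma counit_slice_arr: "over_cod z \<Longrightarrow> (p \<cdot>\<^bsub>X\<^esub> P z, E z, z) \<in> Arr (slice X (Cod X p))"
  by simp

lemma postcomp_slice_arr:
  "(y, k, y') \<in> Arr (slice X (Dom X p)) \<Longrightarrow>
    (p \<cdot>\<^bsub>X\<^esub> y, k, p \<cdot>\<^bsub>X\<^esub> y') \<in> Arr (slice X (Cod X p))"
  using base.assoc[of k y' p] by simp

lemma N_natural:
  assumes "(y, k, y') \<in> Arr (slice X (Dom X p))"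
  shows "N y' \<cdot>\<^bsub>X\<^esub> k = M (p \<cdot>\<^bsub>X\<^esub> y) k (p \<cdot>\<^bsub>X\<^esub> y') \<cdot>\<^bsub>X\<^esub> N y"
  using unit_natural[of "(y, k, y')" y y'] right_amap_eq[OF postcomp_slice_arr[OF assms]] assms
  by (simp add: unit_eq)

text \<open>\<open>act z\<close> is the canonical descent datum on \<open>P z\<close>, the algebra that the comparison functor
  assigns to \<open>z\<close>.\<close>

definition "act z = M (p \<cdot>\<^bsub>X\<^esub> P z) (E z) z"

lemma act_arr [simp]:
  assumes "over_cod z"
  shows "act z \<in> Arr X" "Dom X (act z) = Dom X (P (p \<cdot>\<^bsub>X\<^esub> P z))" "Cod X (act z) = Dom X (P z)"
    "P z \<cdot>\<^bsub>X\<^esub> act z = P (p \<cdot>\<^bsub>X\<^esub> P z)"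
  using M_arr[OF counit_slice_arr[OF assms]] by (simp_all add: act_def)

lemma E_act: "over_cod z \<Longrightarrow> E z \<cdot>\<^bsub>X\<^esub> act z = E z \<cdot>\<^bsub>X\<^esub> E (p \<cdot>\<^bsub>X\<^esub> P z)"
  using E_natural[OF counit_slice_arr] by (simp add: act_def)

lemma pullback: "over_cod z \<Longrightarrow> is_pullback X p z (P z) (E z)"
  using right_adjoint_pullback[OF base.category_axioms _ adjunction_axioms, of z]
  by (simp add: P_def E_def Hom_def)

text \<open>Arrows into one of the selected pullbacks are compared through the two projections.\<close>

lemma pullback_eqI:
  assumes z: "over_cod z" and s: "s \<in> Arr X" "t \<in> Arr X" "Dom X s = Dom X t"
    "Cod X s = Dom X (P z)" "Cod X t = Dom X (P z)"
    and eq: "P z \<cdot>\<^bsub>X\<^esub> s = P z \<cdot>\<^bsub>X\<^esub> t" "E z \<cdot>\<^bsub>X\<^esub> s = E z \<cdot>\<^bsub>X\<^esub> t"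
  shows "s = t"
proof -
  have "p \<cdot>\<^bsub>X\<^esub> (P z \<cdot>\<^bsub>X\<^esub> s) = z \<cdot>\<^bsub>X\<^esub> (E z \<cdot>\<^bsub>X\<^esub> s)"
    using z s by (simp add: base.assoc[symmetric])
  moreover have "Dom X s \<in> Obj X" "P z \<cdot>\<^bsub>X\<^esub> s \<in> Hom X (Dom X s) (Dom X p)"
    "E z \<cdot>\<^bsub>X\<^esub> s \<in> Hom X (Dom X s) (Dom X z)"
    using z s by (simp_all add: Hom_def)
  ultimately have "\<exists>!h. h \<in> Hom X (Dom X s) (Dom X (P z)) \<and> P z \<cdot>\<^bsub>X\<^esub> h = P z \<cdot>\<^bsub>X\<^esub> s \<and>
      E z \<cdot>\<^bsub>X\<^esub> h = E z \<cdot>\<^bsub>X\<^esub> s"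
    using pullback[OF z] unfolding is_pullback_def by blast
  moreover have "s \<in> Hom X (Dom X s) (Dom X (P z))" "t \<in> Hom X (Dom X s) (Dom X (P z))"
    using s by (simp_all add: Hom_def)
  ultimately show ?thesis using eq by metis
qed

lemma pullback_lift:
  assumes "over_cod z" "s \<in> Arr X" "t \<in> Arr X" "Dom X s = Dom X t" "Cod X s = Dom X p"
    "Cod X t = Dom X z" "p \<cdot>\<^bsub>X\<^esub> s = z \<cdot>\<^bsub>X\<^esub> t"
  obtains h where "h \<in> Arr X" "Dom X h = Dom X s" "Cod X h = Dom X (P z)"
    "P z \<cdot>\<^bsub>X\<^esub> h = s" "E z \<cdot>\<^bsub>X\<^esub> h = t"
proof -
  have "Dom X s \<in> Obj X" "s \<in> Hom X (Dom X s) (Dom X p)" "t \<in> Hom X (Dom X s) (Dom X z)"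
    using assms by (simp_all add: Hom_def)
  then have "\<exists>h. h \<in> Hom X (Dom X s) (Dom X (P z)) \<and> P z \<cdot>\<^bsub>X\<^esub> h = s \<and> E z \<cdot>\<^bsub>X\<^esub> h = t"
    using pullback[OF assms(1)] assms(7) unfolding is_pullback_def by blast
  then show thesis using that by (auto simp: Hom_def)
qed

text \<open>The components of \<open>M z h z'\<close> are \<open>P z\<close> and \<open>h \<cdot> E z\<close>, and only the second one depends on \<open>h\<close>.\<close>

lemma M_eqI:
  assumes a: "(z, h, z') \<in> Arr (slice X (Cod X p))" "(z, h', z') \<in> Arr (slice X (Cod X p))"
    and eq: "h \<cdot>\<^bsub>X\<^esub> E z = h' \<cdot>\<^bsub>X\<^esub> E z"
  shows "M z h z' = M z h' z'"
proof (rule pullback_eqI[of z'])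
  show "over_cod z'" using a by simp
  show "P z' \<cdot>\<^bsub>X\<^esub> M z h z' = P z' \<cdot>\<^bsub>X\<^esub> M z h' z'"
    unfolding M_arr(4)[OF a(1)] M_arr(4)[OF a(2)] ..
  show "E z' \<cdot>\<^bsub>X\<^esub> M z h z' = E z' \<cdot>\<^bsub>X\<^esub> M z h' z'"
    unfolding E_natural[OF a(1)] E_natural[OF a(2)] by (rule eq)
qed (use M_arr[OF a(1)] M_arr[OF a(2)] in simp_all)

section \<open>Descent data\<close>

text \<open>
  A descent datum on \<open>y\<close> is the underlying arrow of an algebra structure for the monad of \<open>p\<^sub>! \<stileturn> p\<^sup>*\<close>.
  The conditions are those of a slice arrow, the unit law and the associative law; \<open>descent_map\<close>
  is equivariance.
\<close>

definition descent_datum where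
  "descent_datum y \<theta> \<longleftrightarrow> over_dom y \<and>
    \<theta> \<in> Arr X \<and> Dom X \<theta> = Dom X (P (p \<cdot>\<^bsub>X\<^esub> y)) \<and> Cod X \<theta> = Dom X y \<and>
    y \<cdot>\<^bsub>X\<^esub> \<theta> = P (p \<cdot>\<^bsub>X\<^esub> y) \<and>
    \<theta> \<cdot>\<^bsub>X\<^esub> N y = Ident X (Dom X y) \<and>
    \<theta> \<cdot>\<^bsub>X\<^esub> M (p \<cdot>\<^bsub>X\<^esub> P (p \<cdot>\<^bsub>X\<^esub> y)) \<theta> (p \<cdot>\<^bsub>X\<^esub> y) = \<theta> \<cdot>\<^bsub>X\<^esub> act (p \<cdot>\<^bsub>X\<^esub> y)"

definition descent_map where
  "descent_map y \<theta> k y' \<theta>' \<longleftrightarrow> k \<in> Arr X \<and> Dom X k = Dom X y \<and> Cod X k = Dom X y' \<and>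
    y' \<cdot>\<^bsub>X\<^esub> k = y \<and> k \<cdot>\<^bsub>X\<^esub> \<theta> = \<theta>' \<cdot>\<^bsub>X\<^esub> M (p \<cdot>\<^bsub>X\<^esub> y) k (p \<cdot>\<^bsub>X\<^esub> y')"

abbreviation "T \<equiv> induced_monad (postcomp X p) R \<eta> \<epsilon>"
abbreviation "EM \<equiv> eilenberg_moore (slice X (Dom X p)) T"
abbreviation "K \<equiv> comparison (slice X (Cod X p)) R \<epsilon>"

lemma T_simps:
  "OMap (Func T) y = P (p \<cdot>\<^bsub>X\<^esub> y)"
  "(y, k, y') \<in> Arr (slice X (Dom X p)) \<Longrightarrow> AMap (Func T) (y, k, y') =
    (P (p \<cdot>\<^bsub>X\<^esub> y), M (p \<cdot>\<^bsub>X\<^esub> y) k (p \<cdot>\<^bsub>X\<^esub> y'), P (p \<cdot>\<^bsub>X\<^esub> y'))"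
  "over_dom y \<Longrightarrow> Unit T y = (y, N y, P (p \<cdot>\<^bsub>X\<^esub> y))"
  "over_dom y \<Longrightarrow> Mult T y = (P (p \<cdot>\<^bsub>X\<^esub> P (p \<cdot>\<^bsub>X\<^esub> y)), act (p \<cdot>\<^bsub>X\<^esub> y), P (p \<cdot>\<^bsub>X\<^esub> y))"
proof -
  show "AMap (Func T) (y, k, y') =
      (P (p \<cdot>\<^bsub>X\<^esub> y), M (p \<cdot>\<^bsub>X\<^esub> y) k (p \<cdot>\<^bsub>X\<^esub> y'), P (p \<cdot>\<^bsub>X\<^esub> y'))"
    if "(y, k, y') \<in> Arr (slice X (Dom X p))"
    using right_amap_eq[OF postcomp_slice_arr[OF that]]
    by (simp add: induced_monad_def comp_func_def)
  show "Mult T y = (P (p \<cdot>\<^bsub>X\<^esub> P (p \<cdot>\<^bsub>X\<^esub> y)), act (p \<cdot>\<^bsub>X\<^esub> y), P (p \<cdot>\<^bsub>X\<^esub> y))"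
    if "over_dom y"
    using right_amap_eq[OF counit_slice_arr[of "p \<cdot>\<^bsub>X\<^esub> y"]] that
    by (simp add: induced_monad_def counit_eq act_def)
qed (simp_all add: induced_monad_def comp_func_def P_def[symmetric] unit_eq)

lemma algebra_iff:
  "is_algebra (slice X (Dom X p)) T (y, H) \<longleftrightarrow>
    (\<exists>\<theta>. H = (P (p \<cdot>\<^bsub>X\<^esub> y), \<theta>, y) \<and> descent_datum y \<theta>)"
proof -
  have datum: "is_algebra (slice X (Dom X p)) T (y, (P (p \<cdot>\<^bsub>X\<^esub> y), \<theta>, y)) \<longleftrightarrow> descent_datum y \<theta>"
    if "over_dom y" "(P (p \<cdot>\<^bsub>X\<^esub> y), \<theta>, y) \<in> Arr (slice X (Dom X p))" for \<theta>
    using that unfolding is_algebra_def descent_datum_def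
    by (simp add: T_simps(1) T_simps(2)[OF that(2)] T_simps(3,4)[OF that(1)])
  show ?thesis
  proof
    assume a: "is_algebra (slice X (Dom X p)) T (y, H)"
    then have y: "over_dom y" and H: "H \<in> Hom (slice X (Dom X p)) (P (p \<cdot>\<^bsub>X\<^esub> y)) y"
      by (simp_all add: is_algebra_def T_simps(1))
    obtain \<theta> where H: "H = (P (p \<cdot>\<^bsub>X\<^esub> y), \<theta>, y)"
      "(P (p \<cdot>\<^bsub>X\<^esub> y), \<theta>, y) \<in> Arr (slice X (Dom X p))"
      using H by (rule slice_homE)
    show "\<exists>\<theta>. H = (P (p \<cdot>\<^bsub>X\<^esub> y), \<theta>, y) \<and> descent_datum y \<theta>"
      using a datum[OF y H(2)] H(1) by blast
  next
    assume "\<exists>\<theta>. H = (P (p \<cdot>\<^bsub>X\<^esub> y), \<theta>, y) \<and> descent_datum y \<theta>"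
    then obtain \<theta> where H: "H = (P (p \<cdot>\<^bsub>X\<^esub> y), \<theta>, y)" and d: "descent_datum y \<theta>"
      by blast
    have y: "over_dom y" using d by (simp add: descent_datum_def)
    have "(P (p \<cdot>\<^bsub>X\<^esub> y), \<theta>, y) \<in> Arr (slice X (Dom X p))"
      using d by (simp add: descent_datum_def)
    then show "is_algebra (slice X (Dom X p)) T (y, H)" using datum[OF y] d H by blast
  qed
qed

lemma EM_arr_iff:
  "((y, H), (y1, k, y1'), (y', H')) \<in> Arr EM \<longleftrightarrow> y1 = y \<and> y1' = y' \<and>
    (\<exists>\<theta> \<theta>'. H = (P (p \<cdot>\<^bsub>X\<^esub> y), \<theta>, y) \<and> H' = (P (p \<cdot>\<^bsub>X\<^esub> y'), \<theta>', y') \<and>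
      descent_datum y \<theta> \<and> descent_datum y' \<theta>' \<and> descent_map y \<theta> k y' \<theta>')"
  (is "?arr \<longleftrightarrow> ?R")
proof -
  have *: "(y, k, y') \<in> Arr (slice X (Dom X p)) \<and>
      (y, k, y') \<cdot>\<^bsub>slice X (Dom X p)\<^esub> (P (p \<cdot>\<^bsub>X\<^esub> y), \<theta>, y) =
      (P (p \<cdot>\<^bsub>X\<^esub> y'), \<theta>', y') \<cdot>\<^bsub>slice X (Dom X p)\<^esub> AMap (Func T) (y, k, y')
      \<longleftrightarrow> descent_map y \<theta> k y' \<theta>'" if d: "descent_datum y \<theta>" "descent_datum y' \<theta>'" for \<theta> \<theta>'
  proof (cases "(y, k, y') \<in> Arr (slice X (Dom X p))")
    case True
    then show ?thesis
      unfolding descent_map_def T_simps(2)[OF True] slice_simps by simp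
  next
    case False
    then show ?thesis
      using d unfolding descent_map_def descent_datum_def slice_arr by blast
  qed
  have arr: "?arr \<longleftrightarrow> is_algebra (slice X (Dom X p)) T (y, H) \<and>
      is_algebra (slice X (Dom X p)) T (y', H') \<and> y1 = y \<and> y1' = y' \<and>
      (y, k, y') \<in> Arr (slice X (Dom X p)) \<and>
      (y, k, y') \<cdot>\<^bsub>slice X (Dom X p)\<^esub> H = H' \<cdot>\<^bsub>slice X (Dom X p)\<^esub> AMap (Func T) (y, k, y')"
  proof -
    have "(y1, k, y1') \<in> Hom (slice X (Dom X p)) y y' \<longleftrightarrow>
        y1 = y \<and> y1' = y' \<and> (y, k, y') \<in> Arr (slice X (Dom X p))"
      unfolding slice_hom_iff by blast
    then show ?thesis
      by (simp only: eilenberg_moore_def cat.simps mem_Collect_eq prod.case fst_conv snd_conv) blast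
  qed
  show ?thesis
    unfolding arr algebra_iff using * by blast
qed

lemma K_simps:
  assumes "(z, h, z') \<in> Arr (slice X (Cod X p))"
  shows "AMap K (z, h, z') = ((P z, (P (p \<cdot>\<^bsub>X\<^esub> P z), act z, P z)), (P z, M z h z', P z'),
    (P z', (P (p \<cdot>\<^bsub>X\<^esub> P z'), act z', P z')))"
  using assms right_amap_eq[OF assms] right_amap_eq[OF counit_slice_arr[of z]]
    right_amap_eq[OF counit_slice_arr[of z']]
  by (simp add: comparison_def counit_eq P_def[symmetric] act_def)

lemma K_obj:
  assumes "over_cod z"
  shows "OMap K z = (P z, (P (p \<cdot>\<^bsub>X\<^esub> P z), act z, P z))"
  using assms right_amap_eq[OF counit_slice_arr[of z]]
  by (simp add: comparison_def counit_eq P_def[symmetric] act_def)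

lemma descent_datum_act: "over_cod z \<Longrightarrow> descent_datum (P z) (act z)"
  using comparison_algebra[of z] right_amap_eq[OF counit_slice_arr[of z]]
  by (simp add: counit_eq P_def[symmetric] act_def algebra_iff)

lemma act_N: "over_cod z \<Longrightarrow> act z \<cdot>\<^bsub>X\<^esub> N (P z) = Ident X (Dom X (P z))"
  using descent_datum_act unfolding descent_datum_def by blast

lemma EM_iso_iff:
  "is_iso EM ((y, H), (y1, k, y1'), (y', H')) \<longleftrightarrow>
    ((y, H), (y1, k, y1'), (y', H')) \<in> Arr EM \<and> is_iso X k"
proof -
  interpret m: monad "slice X (Dom X p)" T by (rule induced_monad_is_monad[OF adjunction_axioms])
  show ?thesis
    unfolding m.eilenberg_moore_iso_iff base.slice_iso_iff
    by (auto simp: EM_arr_iff descent_map_def descent_datum_def)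
qed

text \<open>
  The next three properties say that the comparison functor is faithful, full and essentially
  surjective, in terms of arrows of the base.
\<close>

definition descent_faithful where
  "descent_faithful \<longleftrightarrow> (\<forall>z z' h h'. (z, h, z') \<in> Arr (slice X (Cod X p)) \<longrightarrow>
    (z, h', z') \<in> Arr (slice X (Cod X p)) \<longrightarrow> M z h z' = M z h' z' \<longrightarrow> h = h')"

definition descent_full where
  "descent_full \<longleftrightarrow> (\<forall>z z' k. over_cod z \<longrightarrow> over_cod z' \<longrightarrow>
    descent_map (P z) (act z) k (P z') (act z') \<longrightarrow>
    (\<exists>h. (z, h, z') \<in> Arr (slice X (Cod X p)) \<and> M z h z' = k))"

definition descent_effective where
  "descent_effective \<longleftrightarrow> (\<forall>y \<theta>. descent_datum y \<theta> \<longrightarrow>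
    (\<exists>z k. over_cod z \<and> descent_map (P z) (act z) k y \<theta> \<and> is_iso X k))"

lemma fully_faithful_iff:
  "fully_faithful (slice X (Cod X p)) EM K \<longleftrightarrow> descent_faithful \<and> descent_full"
proof (intro iffI conjI)
  assume ff: "fully_faithful (slice X (Cod X p)) EM K"
  show "descent_faithful"
    unfolding descent_faithful_def
  proof (intro allI impI)
    fix z z' h h'
    assume a: "(z, h, z') \<in> Arr (slice X (Cod X p))" "(z, h', z') \<in> Arr (slice X (Cod X p))"
      and eq: "M z h z' = M z h' z'"
    have "inj_on (AMap K) (Hom (slice X (Cod X p)) z z')"
      using ff a unfolding fully_faithful_def bij_betw_def by simp
    moreover have "AMap K (z, h, z') = AMap K (z, h', z')" using a eq by (simp only: K_simps)
    ultimately have "(z, h, z') = (z, h', z')" by (rule inj_onD) (use a in simp_all)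
    then show "h = h'" by simp
  qed
  show "descent_full"
    unfolding descent_full_def
  proof (intro allI impI)
    fix z z' k
    assume z: "over_cod z" "over_cod z'" and k: "descent_map (P z) (act z) k (P z') (act z')"
    have "(OMap K z, (P z, k, P z'), OMap K z') \<in> Arr EM"
      unfolding K_obj[OF z(1)] K_obj[OF z(2)] EM_arr_iff
      using k descent_datum_act[OF z(1)] descent_datum_act[OF z(2)] by simp
    then have "(OMap K z, (P z, k, P z'), OMap K z') \<in> Hom EM (OMap K z) (OMap K z')"
      unfolding Hom_def mem_Collect_eq eilenberg_moore_simps by (simp only: simp_thms)
    moreover have "AMap K ` Hom (slice X (Cod X p)) z z' = Hom EM (OMap K z) (OMap K z')"
      using ff z unfolding fully_faithful_def bij_betw_def by simp
    ultimately have "(OMap K z, (P z, k, P z'), OMap K z') \<in> AMap K ` Hom (slice X (Cod X p)) z z'"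
      by simp
    then obtain t where t: "t \<in> Hom (slice X (Cod X p)) z z'"
      and eq: "(OMap K z, (P z, k, P z'), OMap K z') = AMap K t" by (rule imageE)
    obtain h where h: "t = (z, h, z')" "(z, h, z') \<in> Arr (slice X (Cod X p))"
      using t by (rule slice_homE)
    then show "\<exists>h. (z, h, z') \<in> Arr (slice X (Cod X p)) \<and> M z h z' = k"
      using eq unfolding h(1) K_simps[OF h(2)] by blast
  qed
next
  assume *: "descent_faithful \<and> descent_full"
  interpret K: is_functor "slice X (Cod X p)" EM K by (rule comparison_functor)
  show "fully_faithful (slice X (Cod X p)) EM K"
    unfolding fully_faithful_def bij_betw_def
  proof (intro ballI conjI inj_onI equalityI subsetI)
    fix z z' t t'
    assume "t \<in> Hom (slice X (Cod X p)) z z'" "t' \<in> Hom (slice X (Cod X p)) z z'"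
      and eq: "AMap K t = AMap K t'"
    then obtain h h' where h: "t = (z, h, z')" "(z, h, z') \<in> Arr (slice X (Cod X p))"
      "t' = (z, h', z')" "(z, h', z') \<in> Arr (slice X (Cod X p))" by (metis slice_homE)
    have "M z h z' = M z h' z'" using eq h by (simp del: slice_arr add: K_simps)
    then show "t = t'" using * h unfolding descent_faithful_def by blast
  next
    fix z z' t
    assume "t \<in> AMap K ` Hom (slice X (Cod X p)) z z'"
    then show "t \<in> Hom EM (OMap K z) (OMap K z')" by (rule imageE) (simp only: K.amap_hom)
  next
    fix z z' t
    assume z: "z \<in> Obj (slice X (Cod X p))" "z' \<in> Obj (slice X (Cod X p))"
      and t: "t \<in> Hom EM (OMap K z) (OMap K z')"
    then have z: "over_cod z" "over_cod z'" by simp_all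
    obtain s where "t = (OMap K z, s, OMap K z')" "(OMap K z, s, OMap K z') \<in> Arr EM"
      using t by (rule eilenberg_moore_homE)
    moreover obtain y k y' where "s = (y, k, y')" by (metis surj_pair)
    ultimately have teq: "t = (OMap K z, (y, k, y'), OMap K z')"
      and arr: "(OMap K z, (y, k, y'), OMap K z') \<in> Arr EM" by (simp_all only:)
    have y: "y = P z" "y' = P z'" and "descent_map (P z) (act z) k (P z') (act z')"
      using arr unfolding K_obj[OF z(1)] K_obj[OF z(2)] EM_arr_iff prod.inject by metis+
    then obtain h where h: "(z, h, z') \<in> Arr (slice X (Cod X p))" "M z h z' = k"
      using * z unfolding descent_full_def by blast
    have "t = AMap K (z, h, z')"
      unfolding teq K_simps[OF h(1)] K_obj[OF z(1)] K_obj[OF z(2)] y h(2) by simp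
    then show "t \<in> AMap K ` Hom (slice X (Cod X p)) z z'"
      using h(1) by (auto intro!: imageI)
  qed
qed

lemma essentially_surjective_iff:
  "essentially_surjective (slice X (Cod X p)) EM K \<longleftrightarrow> descent_effective"
proof
  assume es: "essentially_surjective (slice X (Cod X p)) EM K"
  show "descent_effective"
    unfolding descent_effective_def
  proof (intro allI impI)
    fix y \<theta>
    assume d: "descent_datum y \<theta>"
    let ?H = "(P (p \<cdot>\<^bsub>X\<^esub> y), \<theta>, y)"
    have "(y, ?H) \<in> Obj EM" unfolding eilenberg_moore_simps algebra_iff using d by simp
    then have "\<exists>z \<in> Obj (slice X (Cod X p)). \<exists>t \<in> Hom EM (OMap K z) (y, ?H). is_iso EM t"
      by (rule bspec[OF es[unfolded essentially_surjective_def]])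
    then obtain z t where "z \<in> Obj (slice X (Cod X p))"
      and t: "t \<in> Hom EM (OMap K z) (y, ?H)" "is_iso EM t"
      by (elim bexE) (rule that)
    then have z: "over_cod z" by simp
    obtain s where "t = (OMap K z, s, (y, ?H))"
      using t(1) by (rule eilenberg_moore_homE)
    moreover obtain y1 k y2 where "s = (y1, k, y2)" by (metis surj_pair)
    ultimately have teq: "t = (OMap K z, (y1, k, y2), (y, ?H))" by (simp only:)
    show "\<exists>z k. over_cod z \<and> descent_map (P z) (act z) k y \<theta> \<and> is_iso X k"
    proof (intro exI conjI)
      have "((P z, (P (p \<cdot>\<^bsub>X\<^esub> P z), act z, P z)), (y1, k, y2), (y, ?H)) \<in> Arr EM \<and> is_iso X k"
        using t(2) unfolding teq K_obj[OF z] EM_iso_iff .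
      then show "descent_map (P z) (act z) k y \<theta>" "is_iso X k"
        unfolding EM_arr_iff prod.inject by metis+
    qed (use z in simp_all)
  qed
next
  assume *: descent_effective
  show "essentially_surjective (slice X (Cod X p)) EM K"
    unfolding essentially_surjective_def
  proof
    fix D assume "D \<in> Obj EM"
    moreover obtain y H where yH: "D = (y, H)" by (metis surj_pair)
    ultimately obtain \<theta> where "H = (P (p \<cdot>\<^bsub>X\<^esub> y), \<theta>, y)" and d: "descent_datum y \<theta>"
      unfolding eilenberg_moore_simps yH algebra_iff by (elim exE conjE) (rule that)
    then have D: "D = (y, (P (p \<cdot>\<^bsub>X\<^esub> y), \<theta>, y))" using yH by (simp only:)
    obtain z k where z: "over_cod z" and k: "descent_map (P z) (act z) k y \<theta>" "is_iso X k"
      using * d unfolding descent_effective_def by blast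
    have "is_iso EM (OMap K z, (P z, k, y), D)"
      unfolding D K_obj[OF z] EM_iso_iff EM_arr_iff using k d descent_datum_act[OF z] by simp
    moreover from this have "(OMap K z, (P z, k, y), D) \<in> Hom EM (OMap K z) D"
      unfolding is_iso_def[of EM] Hom_def mem_Collect_eq eilenberg_moore_simps by (elim conjE, intro conjI refl)
    ultimately show "\<exists>x \<in> Obj (slice X (Cod X p)). \<exists>t \<in> Hom EM (OMap K x) D. is_iso EM t"
      using z by (intro bexI[of _ z] bexI[of _ "(OMap K z, (P z, k, y), D)"]) simp_all
  qed
qed

lemma monadic_iff:
  "monadic_adjunction (slice X (Dom X p)) (slice X (Cod X p)) (postcomp X p) R \<eta> \<epsilon> \<longleftrightarrow>
    descent_faithful \<and> descent_full \<and> descent_effective"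
  unfolding monadic_adjunction_def
  using adjunction_axioms fully_faithful_iff essentially_surjective_iff
    equivalence_imp_fully_faithful fully_faithful_imp_equivalence[OF comparison_functor]
  by blast

end

section \<open>Stability under pullback\<close>

text \<open>
  Here \<open>q\<close> is a pullback of \<open>p\<close> along \<open>g\<close>. A pullback functor \<open>R'\<close> for \<open>q\<close> is built from \<open>R\<close>, with
  unit and counit, such that \<open>u\<^sub>! R' = R g\<^sub>!\<close> strictly.
\<close>

locale pulled_back_adjunction = pullback_adjunction X p R \<eta> \<epsilon>
  for X :: "('o, 'm) cat" and p :: 'm and R \<eta> \<epsilon> +
  fixes g q u :: 'm
  assumes square: "is_pullback X g p q u"
begin

lemma square_arr [simp]:
  "g \<in> Arr X" "q \<in> Arr X" "u \<in> Arr X" "Cod X g = Cod X p" "Cod X q = Dom X g"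
  "Cod X u = Dom X p" "Dom X u = Dom X q"
  using square unfolding is_pullback_def by simp_all

lemma square_commutes: "g \<cdot>\<^bsub>X\<^esub> q = p \<cdot>\<^bsub>X\<^esub> u"
  using square unfolding is_pullback_def by blast

lemma square_comp:
  assumes "y \<in> Arr X" "Cod X y = Dom X q"
  shows "g \<cdot>\<^bsub>X\<^esub> (q \<cdot>\<^bsub>X\<^esub> y) = p \<cdot>\<^bsub>X\<^esub> (u \<cdot>\<^bsub>X\<^esub> y)"
  using assms by (simp add: base.assoc[symmetric] square_commutes)

lemma square_unique:
  assumes "s \<in> Hom X z (Dom X g)" "t \<in> Hom X z (Dom X p)" "g \<cdot>\<^bsub>X\<^esub> s = p \<cdot>\<^bsub>X\<^esub> t"
  shows "\<exists>!h. h \<in> Hom X z (Dom X q) \<and> q \<cdot>\<^bsub>X\<^esub> h = s \<and> u \<cdot>\<^bsub>X\<^esub> h = t"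
proof -
  have "z \<in> Obj X" using assms(1) by (auto simp: Hom_def)
  then show ?thesis using square assms unfolding is_pullback_def by blast
qed

lemma square_eqI:
  assumes h: "h \<in> Arr X" "h' \<in> Arr X" "Dom X h = Dom X h'" "Cod X h = Dom X q" "Cod X h' = Dom X q"
    and eq: "q \<cdot>\<^bsub>X\<^esub> h = q \<cdot>\<^bsub>X\<^esub> h'" "u \<cdot>\<^bsub>X\<^esub> h = u \<cdot>\<^bsub>X\<^esub> h'"
  shows "h = h'"
proof -
  have "\<exists>!k. k \<in> Hom X (Dom X h) (Dom X q) \<and> q \<cdot>\<^bsub>X\<^esub> k = q \<cdot>\<^bsub>X\<^esub> h \<and> u \<cdot>\<^bsub>X\<^esub> k = u \<cdot>\<^bsub>X\<^esub> h"
    by (rule square_unique) (use h square_comp[of h] in \<open>simp_all add: Hom_def\<close>)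
  moreover have "h \<in> Hom X (Dom X h) (Dom X q)" "h' \<in> Hom X (Dom X h) (Dom X q)"
    using h by (simp_all add: Hom_def)
  ultimately show ?thesis using eq by metis
qed

text \<open>
  By pasting, the pullback of \<open>p\<close> and \<open>g \<cdot> f\<close> is one of \<open>q\<close> and \<open>f\<close>; \<open>P' f\<close> is its projection
  to the domain of \<open>q\<close>.
\<close>

definition "P' f = (THE h. h \<in> Hom X (Dom X (P (g \<cdot>\<^bsub>X\<^esub> f))) (Dom X q) \<and>
  q \<cdot>\<^bsub>X\<^esub> h = f \<cdot>\<^bsub>X\<^esub> E (g \<cdot>\<^bsub>X\<^esub> f) \<and> u \<cdot>\<^bsub>X\<^esub> h = P (g \<cdot>\<^bsub>X\<^esub> f))"

lemma P'_arr [simp]: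
  assumes f: "f \<in> Arr X" "Cod X f = Dom X g"
  shows "P' f \<in> Arr X" "Dom X (P' f) = Dom X (P (g \<cdot>\<^bsub>X\<^esub> f))" "Cod X (P' f) = Dom X q"
    and q_P': "q \<cdot>\<^bsub>X\<^esub> P' f = f \<cdot>\<^bsub>X\<^esub> E (g \<cdot>\<^bsub>X\<^esub> f)" and u_P': "u \<cdot>\<^bsub>X\<^esub> P' f = P (g \<cdot>\<^bsub>X\<^esub> f)"
proof -
  have gf: "over_cod (g \<cdot>\<^bsub>X\<^esub> f)" using f by simp
  have "g \<cdot>\<^bsub>X\<^esub> (f \<cdot>\<^bsub>X\<^esub> E (g \<cdot>\<^bsub>X\<^esub> f)) = p \<cdot>\<^bsub>X\<^esub> P (g \<cdot>\<^bsub>X\<^esub> f)"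
    using base.assoc[of "E (g \<cdot>\<^bsub>X\<^esub> f)" f g] E_arr[OF gf] f by simp
  then have "\<exists>!h. h \<in> Hom X (Dom X (P (g \<cdot>\<^bsub>X\<^esub> f))) (Dom X q) \<and>
      q \<cdot>\<^bsub>X\<^esub> h = f \<cdot>\<^bsub>X\<^esub> E (g \<cdot>\<^bsub>X\<^esub> f) \<and> u \<cdot>\<^bsub>X\<^esub> h = P (g \<cdot>\<^bsub>X\<^esub> f)"
    by (intro square_unique) (use gf f in \<open>simp_all add: Hom_def\<close>)
  from theI'[OF this] have "P' f \<in> Hom X (Dom X (P (g \<cdot>\<^bsub>X\<^esub> f))) (Dom X q) \<and>
      q \<cdot>\<^bsub>X\<^esub> P' f = f \<cdot>\<^bsub>X\<^esub> E (g \<cdot>\<^bsub>X\<^esub> f) \<and> u \<cdot>\<^bsub>X\<^esub> P' f = P (g \<cdot>\<^bsub>X\<^esub> f)"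
    unfolding P'_def .
  then show "P' f \<in> Arr X" "Dom X (P' f) = Dom X (P (g \<cdot>\<^bsub>X\<^esub> f))" "Cod X (P' f) = Dom X q"
    "q \<cdot>\<^bsub>X\<^esub> P' f = f \<cdot>\<^bsub>X\<^esub> E (g \<cdot>\<^bsub>X\<^esub> f)" "u \<cdot>\<^bsub>X\<^esub> P' f = P (g \<cdot>\<^bsub>X\<^esub> f)"
    using gf f by (simp_all add: Hom_def)
qed

lemma g_slice_arr:
  assumes "(f, h, f') \<in> Arr (slice X (Cod X q))"
  shows "(g \<cdot>\<^bsub>X\<^esub> f, h, g \<cdot>\<^bsub>X\<^esub> f') \<in> Arr (slice X (Cod X p))"
  using assms base.assoc[of h f' g] by simp

lemma u_slice_arr:
  assumes "(y, k, y') \<in> Arr (slice X (Dom X q))"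
  shows "(u \<cdot>\<^bsub>X\<^esub> y, k, u \<cdot>\<^bsub>X\<^esub> y') \<in> Arr (slice X (Dom X p))"
  using assms base.assoc[of k y' u] by simp

text \<open>The arrows that \<open>R\<close> induces between pullbacks along \<open>p\<close> lie over the domain of \<open>q\<close>, and so do
  the components of the unit.\<close>

lemma P'_M:
  assumes a: "(f, h, f') \<in> Arr (slice X (Cod X q))"
  shows "P' f' \<cdot>\<^bsub>X\<^esub> M (g \<cdot>\<^bsub>X\<^esub> f) h (g \<cdot>\<^bsub>X\<^esub> f') = P' f"
proof (rule square_eqI)
  note m = M_arr[OF g_slice_arr[OF a]]
  have f: "f \<in> Arr X" "Cod X f = Dom X g" "f' \<in> Arr X" "Cod X f' = Dom X g"
    and h: "h \<in> Arr X" "Dom X h = Dom X f" "Cod X h = Dom X f'" and eq: "f' \<cdot>\<^bsub>X\<^esub> h = f"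
    using a by simp_all
  show "P' f' \<cdot>\<^bsub>X\<^esub> M (g \<cdot>\<^bsub>X\<^esub> f) h (g \<cdot>\<^bsub>X\<^esub> f') \<in> Arr X"
    "Dom X (P' f' \<cdot>\<^bsub>X\<^esub> M (g \<cdot>\<^bsub>X\<^esub> f) h (g \<cdot>\<^bsub>X\<^esub> f')) = Dom X (P' f)"
    "Cod X (P' f' \<cdot>\<^bsub>X\<^esub> M (g \<cdot>\<^bsub>X\<^esub> f) h (g \<cdot>\<^bsub>X\<^esub> f')) = Dom X q"
    "P' f \<in> Arr X" "Cod X (P' f) = Dom X q"
    using f m by simp_all
  have "q \<cdot>\<^bsub>X\<^esub> P' f' \<cdot>\<^bsub>X\<^esub> M (g \<cdot>\<^bsub>X\<^esub> f) h (g \<cdot>\<^bsub>X\<^esub> f')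
      = f' \<cdot>\<^bsub>X\<^esub> (E (g \<cdot>\<^bsub>X\<^esub> f') \<cdot>\<^bsub>X\<^esub> M (g \<cdot>\<^bsub>X\<^esub> f) h (g \<cdot>\<^bsub>X\<^esub> f'))"
    unfolding q_P'[OF f(3,4)] using f m by (intro base.assoc) simp_all
  also have "\<dots> = f' \<cdot>\<^bsub>X\<^esub> h \<cdot>\<^bsub>X\<^esub> E (g \<cdot>\<^bsub>X\<^esub> f)"
    unfolding E_natural[OF g_slice_arr[OF a]] using f h by (intro base.assoc[symmetric]) simp_all
  finally show "q \<cdot>\<^bsub>X\<^esub> (P' f' \<cdot>\<^bsub>X\<^esub> M (g \<cdot>\<^bsub>X\<^esub> f) h (g \<cdot>\<^bsub>X\<^esub> f')) = q \<cdot>\<^bsub>X\<^esub> P' f"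
    unfolding q_P'[OF f(1,2)] eq using base.assoc[OF m(1), of "P' f'" q] f m by simp
  show "u \<cdot>\<^bsub>X\<^esub> (P' f' \<cdot>\<^bsub>X\<^esub> M (g \<cdot>\<^bsub>X\<^esub> f) h (g \<cdot>\<^bsub>X\<^esub> f')) = u \<cdot>\<^bsub>X\<^esub> P' f"
    using base.assoc[OF m(1), of "P' f'" u] f m by (simp add: u_P')
qed

lemma P'_N:
  assumes y: "y \<in> Arr X" "Cod X y = Dom X q"
  shows "P' (q \<cdot>\<^bsub>X\<^esub> y) \<cdot>\<^bsub>X\<^esub> N (u \<cdot>\<^bsub>X\<^esub> y) = y"
proof (rule square_eqI)
  have uy: "over_dom (u \<cdot>\<^bsub>X\<^esub> y)" and qy: "q \<cdot>\<^bsub>X\<^esub> y \<in> Arr X" "Cod X (q \<cdot>\<^bsub>X\<^esub> y) = Dom X g"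
    using y by simp_all
  note n = N_arr[OF uy] and c = square_comp[OF y]
  note p' = P'_arr[OF qy, unfolded c]
  show "P' (q \<cdot>\<^bsub>X\<^esub> y) \<cdot>\<^bsub>X\<^esub> N (u \<cdot>\<^bsub>X\<^esub> y) \<in> Arr X"
    "Dom X (P' (q \<cdot>\<^bsub>X\<^esub> y) \<cdot>\<^bsub>X\<^esub> N (u \<cdot>\<^bsub>X\<^esub> y)) = Dom X y"
    "Cod X (P' (q \<cdot>\<^bsub>X\<^esub> y) \<cdot>\<^bsub>X\<^esub> N (u \<cdot>\<^bsub>X\<^esub> y)) = Dom X q" "y \<in> Arr X" "Cod X y = Dom X q"
    using n p' y by simp_all
  have "q \<cdot>\<^bsub>X\<^esub> (P' (q \<cdot>\<^bsub>X\<^esub> y) \<cdot>\<^bsub>X\<^esub> N (u \<cdot>\<^bsub>X\<^esub> y)) =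
      q \<cdot>\<^bsub>X\<^esub> y \<cdot>\<^bsub>X\<^esub> E (p \<cdot>\<^bsub>X\<^esub> (u \<cdot>\<^bsub>X\<^esub> y)) \<cdot>\<^bsub>X\<^esub> N (u \<cdot>\<^bsub>X\<^esub> y)"
    using base.assoc[OF n(1) p'(1) square_arr(2)] n p' by simp
  also have "\<dots> = q \<cdot>\<^bsub>X\<^esub> y \<cdot>\<^bsub>X\<^esub> (E (p \<cdot>\<^bsub>X\<^esub> (u \<cdot>\<^bsub>X\<^esub> y)) \<cdot>\<^bsub>X\<^esub> N (u \<cdot>\<^bsub>X\<^esub> y))"
    using n y by (intro base.assoc) simp_all
  also have "\<dots> = q \<cdot>\<^bsub>X\<^esub> y" unfolding E_N[OF uy] using y by simp
  finally show "q \<cdot>\<^bsub>X\<^esub> (P' (q \<cdot>\<^bsub>X\<^esub> y) \<cdot>\<^bsub>X\<^esub> N (u \<cdot>\<^bsub>X\<^esub> y)) = q \<cdot>\<^bsub>X\<^esub> y" .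
  show "u \<cdot>\<^bsub>X\<^esub> (P' (q \<cdot>\<^bsub>X\<^esub> y) \<cdot>\<^bsub>X\<^esub> N (u \<cdot>\<^bsub>X\<^esub> y)) = u \<cdot>\<^bsub>X\<^esub> y"
    using base.assoc[OF n(1) p'(1) square_arr(3)] n p' by simp
qed

definition "R' = \<lparr>OMap = P', AMap = (\<lambda>(f, h, f'). (P' f, M (g \<cdot>\<^bsub>X\<^esub> f) h (g \<cdot>\<^bsub>X\<^esub> f'), P' f'))\<rparr>"
definition "\<eta>' y = (y, N (u \<cdot>\<^bsub>X\<^esub> y), P' (q \<cdot>\<^bsub>X\<^esub> y))"
definition "\<epsilon>' f = (q \<cdot>\<^bsub>X\<^esub> P' f, E (g \<cdot>\<^bsub>X\<^esub> f), f)"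

lemma R'_simps:
  "OMap R' f = P' f" "AMap R' (f, h, f') = (P' f, M (g \<cdot>\<^bsub>X\<^esub> f) h (g \<cdot>\<^bsub>X\<^esub> f'), P' f')"
  by (simp_all add: R'_def)

lemma R'_functor: "is_functor (slice X (Cod X q)) (slice X (Dom X q)) R'"
proof -
  interpret c: category "slice X (Cod X q)" by (rule base.slice_category)
  interpret d: category "slice X (Dom X q)" by (rule base.slice_category)
  show ?thesis
  proof (unfold_locales, goal_cases)
    case (1 x)
    then show ?case by (simp add: R'_simps)
  next
    case (2 t x y)
    obtain h where t: "t = (x, h, y)" and a: "(x, h, y) \<in> Arr (slice X (Cod X q))"
      using 2 by (rule slice_homE)
    show ?case
      unfolding t R'_simps using a P'_M[OF a] M_arr[OF g_slice_arr[OF a]] by simp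
  next
    case (3 x)
    then show ?case using M_ident[of "g \<cdot>\<^bsub>X\<^esub> x"] by (simp add: R'_simps)
  next
    case (4 s x y t z)
    obtain h where s: "s = (x, h, y)" and a: "(x, h, y) \<in> Arr (slice X (Cod X q))"
      using 4(1) by (rule slice_homE)
    obtain k where t: "t = (y, k, z)" and b: "(y, k, z) \<in> Arr (slice X (Cod X q))"
      using 4(2) by (rule slice_homE)
    show ?case
      unfolding s t R'_simps slice_simps M_comp[OF g_slice_arr[OF a] g_slice_arr[OF b]] ..
  qed
qed

lemma square_counit:
  assumes "f \<in> Arr X" "Cod X f = Dom X g"
  shows "g \<cdot>\<^bsub>X\<^esub> (q \<cdot>\<^bsub>X\<^esub> P' f) = p \<cdot>\<^bsub>X\<^esub> P (g \<cdot>\<^bsub>X\<^esub> f)"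
  using square_comp[of "P' f"] assms u_P'[OF assms] by simp

text \<open>
  Composition in a slice is composition of underlying arrows, and these are the same as for \<open>p\<close>
  at the objects \<open>g \<cdot> f\<close> and \<open>u \<cdot> y\<close>. Each law for \<open>q\<close> is therefore literally the law for \<open>p\<close>.
\<close>

lemma pulled_back_adjunction:
  "adjunction (slice X (Dom X q)) (slice X (Cod X q)) (postcomp X q) R' \<eta>' \<epsilon>'"
proof (rule adjunctionI)
  show "is_functor (slice X (Dom X q)) (slice X (Cod X q)) (postcomp X q)"
    by (rule base.postcomp_functor) simp
  show "is_functor (slice X (Cod X q)) (slice X (Dom X q)) R'" by (rule R'_functor)
next
  fix y assume "y \<in> Obj (slice X (Dom X q))"
  then have y: "y \<in> Arr X" "Cod X y = Dom X q" by simp_all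
  have uy: "over_dom (u \<cdot>\<^bsub>X\<^esub> y)" using y by simp
  show "\<eta>' y \<in> Hom (slice X (Dom X q)) y (OMap R' (OMap (postcomp X q) y))"
    unfolding \<eta>'_def R'_simps postcomp_simps slice_hom_iff
    using y P'_N[OF y] N_arr[OF uy] square_comp[OF y] by simp
  show "\<epsilon>' (OMap (postcomp X q) y) \<cdot>\<^bsub>slice X (Cod X q)\<^esub> AMap (postcomp X q) (\<eta>' y) =
      Ident (slice X (Cod X q)) (OMap (postcomp X q) y)"
    unfolding \<eta>'_def \<epsilon>'_def postcomp_simps slice_simps square_comp[OF y] E_N[OF uy]
    using y by simp
next
  fix t y y' assume "t \<in> Hom (slice X (Dom X q)) y y'"
  then obtain k where t: "t = (y, k, y')" and a: "(y, k, y') \<in> Arr (slice X (Dom X q))"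
    by (rule slice_homE)
  have y: "y \<in> Arr X" "Cod X y = Dom X q" "y' \<in> Arr X" "Cod X y' = Dom X q" using a by simp_all
  show "\<eta>' y' \<cdot>\<^bsub>slice X (Dom X q)\<^esub> t = AMap R' (AMap (postcomp X q) t) \<cdot>\<^bsub>slice X (Dom X q)\<^esub> \<eta>' y"
    unfolding \<eta>'_def t postcomp_simps R'_simps slice_simps square_comp[OF y(1,2)]
      square_comp[OF y(3,4)] N_natural[OF u_slice_arr[OF a]] ..
next
  fix f assume "f \<in> Obj (slice X (Cod X q))"
  then have f: "f \<in> Arr X" "Cod X f = Dom X g" by simp_all
  have gf: "over_cod (g \<cdot>\<^bsub>X\<^esub> f)" using f by simp
  show "\<epsilon>' f \<in> Hom (slice X (Cod X q)) (OMap (postcomp X q) (OMap R' f)) f"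
    unfolding \<epsilon>'_def R'_simps postcomp_simps slice_hom_iff slice_arr
    using f E_arr[OF gf] P'_arr[OF f] by simp
  show "AMap R' (\<epsilon>' f) \<cdot>\<^bsub>slice X (Dom X q)\<^esub> \<eta>' (OMap R' f) =
      Ident (slice X (Dom X q)) (OMap R' f)"
    unfolding \<epsilon>'_def \<eta>'_def R'_simps slice_simps square_counit[OF f] u_P'[OF f]
      act_def[symmetric] act_N[OF gf] P'_arr(2)[OF f] ..
next
  fix t f f' assume "t \<in> Hom (slice X (Cod X q)) f f'"
  then obtain h where t: "t = (f, h, f')" and a: "(f, h, f') \<in> Arr (slice X (Cod X q))"
    by (rule slice_homE)
  show "\<epsilon>' f' \<cdot>\<^bsub>slice X (Cod X q)\<^esub> AMap (postcomp X q) (AMap R' t) =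
      t \<cdot>\<^bsub>slice X (Cod X q)\<^esub> \<epsilon>' f"
    unfolding \<epsilon>'_def t R'_simps postcomp_simps slice_simps E_natural[OF g_slice_arr[OF a]] ..
qed

sublocale pb: pullback_adjunction X q R' \<eta>' \<epsilon>'
proof (rule pullback_adjunction.intro)
  show "pullback_adjunction_axioms X q" by unfold_locales simp
qed (rule base.category_axioms pulled_back_adjunction)+

lemma pb_simps:
  "pb.P f = P' f" "pb.E f = E (g \<cdot>\<^bsub>X\<^esub> f)" "pb.M f h f' = M (g \<cdot>\<^bsub>X\<^esub> f) h (g \<cdot>\<^bsub>X\<^esub> f')"
  "pb.N y = N (u \<cdot>\<^bsub>X\<^esub> y)"
  unfolding pb.P_def pb.E_def pb.M_def pb.N_def R'_simps \<eta>'_def \<epsilon>'_def by simp_all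

lemma pb_act:
  assumes "f \<in> Arr X" "Cod X f = Dom X g"
  shows "pb.act f = act (g \<cdot>\<^bsub>X\<^esub> f)"
  unfolding pb.act_def act_def pb_simps square_counit[OF assms] ..

text \<open>The unit and associative laws for \<open>y\<close> and for \<open>u \<cdot> y\<close> are the same equations.\<close>

lemma descent_datum_postcomp:
  assumes d: "pb.descent_datum y \<theta>"
  shows "descent_datum (u \<cdot>\<^bsub>X\<^esub> y) \<theta>"
proof -
  have y: "y \<in> Arr X" "Cod X y = Dom X q" using d unfolding pb.descent_datum_def by simp_all
  have qy: "q \<cdot>\<^bsub>X\<^esub> y \<in> Arr X" "Cod X (q \<cdot>\<^bsub>X\<^esub> y) = Dom X g" using y by simp_all
  note p' = P'_arr[OF qy, unfolded square_comp[OF y]]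
  have \<theta>: "\<theta> \<in> Arr X" "Dom X \<theta> = Dom X (P (p \<cdot>\<^bsub>X\<^esub> (u \<cdot>\<^bsub>X\<^esub> y)))" "Cod X \<theta> = Dom X y"
    "y \<cdot>\<^bsub>X\<^esub> \<theta> = P' (q \<cdot>\<^bsub>X\<^esub> y)" "\<theta> \<cdot>\<^bsub>X\<^esub> N (u \<cdot>\<^bsub>X\<^esub> y) = Ident X (Dom X y)"
    "\<theta> \<cdot>\<^bsub>X\<^esub> M (p \<cdot>\<^bsub>X\<^esub> P (p \<cdot>\<^bsub>X\<^esub> (u \<cdot>\<^bsub>X\<^esub> y))) \<theta> (p \<cdot>\<^bsub>X\<^esub> (u \<cdot>\<^bsub>X\<^esub> y)) =
      \<theta> \<cdot>\<^bsub>X\<^esub> act (p \<cdot>\<^bsub>X\<^esub> (u \<cdot>\<^bsub>X\<^esub> y))"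
    using d unfolding pb.descent_datum_def pb_simps pb_act[OF qy] square_counit[OF qy]
      square_comp[OF y] p'(2) by blast+
  have "u \<cdot>\<^bsub>X\<^esub> y \<cdot>\<^bsub>X\<^esub> \<theta> = P (p \<cdot>\<^bsub>X\<^esub> (u \<cdot>\<^bsub>X\<^esub> y))"
    using base.assoc[OF \<theta>(1) y(1) square_arr(3)] \<theta>(3,4) y p'(5) by simp
  then show ?thesis
    unfolding descent_datum_def using y \<theta> by simp
qed

lemma descent_map_postcomp:
  assumes y: "y \<in> Arr X" "Cod X y = Dom X q" "y' \<in> Arr X" "Cod X y' = Dom X q"
  shows "pb.descent_map y \<theta> k y' \<theta>' \<longleftrightarrow>
    descent_map (u \<cdot>\<^bsub>X\<^esub> y) \<theta> k (u \<cdot>\<^bsub>X\<^esub> y') \<theta>' \<and> y' \<cdot>\<^bsub>X\<^esub> k = y"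
  unfolding pb.descent_map_def descent_map_def pb_simps square_comp[OF y(1,2)]
    square_comp[OF y(3,4)]
  using y base.assoc[of k y' u] by auto

lemma pb_faithful:
  assumes descent_faithful
  shows "pb.descent_faithful"
  unfolding pb.descent_faithful_def pb_simps
proof (intro allI impI)
  fix f f' h h'
  assume "(f, h, f') \<in> Arr (slice X (Cod X q))" "(f, h', f') \<in> Arr (slice X (Cod X q))"
    "M (g \<cdot>\<^bsub>X\<^esub> f) h (g \<cdot>\<^bsub>X\<^esub> f') = M (g \<cdot>\<^bsub>X\<^esub> f) h' (g \<cdot>\<^bsub>X\<^esub> f')"
  then show "h = h'"
    using assms g_slice_arr unfolding descent_faithful_def by blast
qed

text \<open>
  Fullness for \<open>p\<close> yields \<open>h : g \<cdot> f \<rightarrow> g \<cdot> f'\<close> over \<open>b = Cod p\<close>. That \<open>h\<close> lies over the domain of \<open>g\<close>,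
  \<open>f' \<cdot> h = f\<close>, is an equation between two arrows \<open>g \<cdot> f \<rightarrow> g\<close> of the slice over \<open>b\<close>; they agree
  after composition with \<open>E (g \<cdot> f)\<close>, hence after pulling back along \<open>p\<close>, and faithfulness applies.
\<close>

lemma pb_full:
  assumes faithful: descent_faithful and full: descent_full
  shows "pb.descent_full"
  unfolding pb.descent_full_def
proof (intro allI impI)
  fix f f' k
  assume "pb.over_cod f" "pb.over_cod f'"
  then have f: "f \<in> Arr X" "Cod X f = Dom X g" "f' \<in> Arr X" "Cod X f' = Dom X g" by simp_all
  have gf: "over_cod (g \<cdot>\<^bsub>X\<^esub> f)" "over_cod (g \<cdot>\<^bsub>X\<^esub> f')" using f by simp_all
  assume "pb.descent_map (pb.P f) (pb.act f) k (pb.P f') (pb.act f')"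
  then have "descent_map (P (g \<cdot>\<^bsub>X\<^esub> f)) (act (g \<cdot>\<^bsub>X\<^esub> f)) k (P (g \<cdot>\<^bsub>X\<^esub> f')) (act (g \<cdot>\<^bsub>X\<^esub> f'))"
    and P'k: "P' f' \<cdot>\<^bsub>X\<^esub> k = P' f"
    unfolding pb_simps pb_act[OF f(1,2)] pb_act[OF f(3,4)]
      descent_map_postcomp[OF P'_arr(1,3)[OF f(1,2)] P'_arr(1,3)[OF f(3,4)]]
      u_P'[OF f(1,2)] u_P'[OF f(3,4)] by blast+
  then obtain h where a: "(g \<cdot>\<^bsub>X\<^esub> f, h, g \<cdot>\<^bsub>X\<^esub> f') \<in> Arr (slice X (Cod X p))"
    and k: "M (g \<cdot>\<^bsub>X\<^esub> f) h (g \<cdot>\<^bsub>X\<^esub> f') = k"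
    using full gf unfolding descent_full_def by blast
  have h: "h \<in> Arr X" "Dom X h = Dom X f" "Cod X h = Dom X f'"
    "g \<cdot>\<^bsub>X\<^esub> f' \<cdot>\<^bsub>X\<^esub> h = g \<cdot>\<^bsub>X\<^esub> f" using a f by simp_all
  have "f' \<cdot>\<^bsub>X\<^esub> h \<cdot>\<^bsub>X\<^esub> E (g \<cdot>\<^bsub>X\<^esub> f) = f' \<cdot>\<^bsub>X\<^esub> (h \<cdot>\<^bsub>X\<^esub> E (g \<cdot>\<^bsub>X\<^esub> f))"
    using f h E_arr[OF gf(1)] by (intro base.assoc) simp_all
  also have "\<dots> = f' \<cdot>\<^bsub>X\<^esub> (E (g \<cdot>\<^bsub>X\<^esub> f') \<cdot>\<^bsub>X\<^esub> k)"
    unfolding E_natural[OF a, symmetric] k ..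
  also have "\<dots> = f' \<cdot>\<^bsub>X\<^esub> E (g \<cdot>\<^bsub>X\<^esub> f') \<cdot>\<^bsub>X\<^esub> k"
    using f E_arr[OF gf(2)] M_arr[OF a] unfolding k by (intro base.assoc[symmetric]) simp_all
  also have "\<dots> = q \<cdot>\<^bsub>X\<^esub> (P' f' \<cdot>\<^bsub>X\<^esub> k)"
    unfolding q_P'[OF f(3,4), symmetric]
    using f P'_arr[OF f(3,4)] M_arr[OF a] unfolding k by (intro base.assoc) simp_all
  also have "\<dots> = f \<cdot>\<^bsub>X\<^esub> E (g \<cdot>\<^bsub>X\<^esub> f)"
    unfolding P'k by (rule q_P'[OF f(1,2)])
  finally have eq: "f' \<cdot>\<^bsub>X\<^esub> h \<cdot>\<^bsub>X\<^esub> E (g \<cdot>\<^bsub>X\<^esub> f) = f \<cdot>\<^bsub>X\<^esub> E (g \<cdot>\<^bsub>X\<^esub> f)" .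
  have a': "(g \<cdot>\<^bsub>X\<^esub> f, f' \<cdot>\<^bsub>X\<^esub> h, g) \<in> Arr (slice X (Cod X p))"
    "(g \<cdot>\<^bsub>X\<^esub> f, f, g) \<in> Arr (slice X (Cod X p))"
    using f h base.assoc[of h f' g] by simp_all
  have "f' \<cdot>\<^bsub>X\<^esub> h = f"
    using faithful a' M_eqI[OF a' eq] unfolding descent_faithful_def by blast
  then show "\<exists>h. (f, h, f') \<in> Arr (slice X (Cod X q)) \<and> pb.M f h f' = k"
    unfolding pb_simps using f h k by (intro exI[of _ h]) simp
qed

text \<open>
  Effectiveness for \<open>p\<close> yields \<open>z\<close> over \<open>b = Cod p\<close> whose pullback is isomorphic to \<open>u \<cdot> y\<close> through an
  equivariant \<open>k\<close>. The arrow \<open>y \<cdot> k\<close> into \<open>Dom q\<close> gives, as \<open>u\<close> and \<open>P g\<close> are both pullbacks of \<open>g\<close>, an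
  arrow \<open>w : P z \<rightarrow> P g\<close>. It is equivariant because the datum on \<open>y\<close> lies over \<open>Dom q\<close>, so
  fullness makes it the pullback of some \<open>f : z \<rightarrow> g\<close>. This \<open>f\<close>, an object over \<open>Dom g\<close>, realises
  \<open>y\<close> through the same \<open>k\<close>.
\<close>

lemma pb_effective:
  assumes full: descent_full and eff: descent_effective
  shows "pb.descent_effective"
  unfolding pb.descent_effective_def
proof (intro allI impI)
  fix y \<theta>
  assume d: "pb.descent_datum y \<theta>"
  then have y: "y \<in> Arr X" "Cod X y = Dom X q" unfolding pb.descent_datum_def by simp_all
  have qy: "q \<cdot>\<^bsub>X\<^esub> y \<in> Arr X" "Cod X (q \<cdot>\<^bsub>X\<^esub> y) = Dom X g" "Dom X (q \<cdot>\<^bsub>X\<^esub> y) = Dom X y"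
    using y by simp_all
  note p' = P'_arr[OF qy(1,2), unfolded square_comp[OF y]]
  have \<theta>: "\<theta> \<in> Arr X" "Dom X \<theta> = Dom X (P (p \<cdot>\<^bsub>X\<^esub> (u \<cdot>\<^bsub>X\<^esub> y)))" "Cod X \<theta> = Dom X y"
    "y \<cdot>\<^bsub>X\<^esub> \<theta> = P' (q \<cdot>\<^bsub>X\<^esub> y)"
    using d unfolding pb.descent_datum_def pb_simps p'(2) by blast+
  obtain z k where z: "over_cod z" and dk: "descent_map (P z) (act z) k (u \<cdot>\<^bsub>X\<^esub> y) \<theta>"
    and iso: "is_iso X k"
    using eff descent_datum_postcomp[OF d] unfolding descent_effective_def by blast
  have k: "k \<in> Arr X" "Dom X k = Dom X (P z)" "Cod X k = Dom X y" "u \<cdot>\<^bsub>X\<^esub> y \<cdot>\<^bsub>X\<^esub> k = P z"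
    "k \<cdot>\<^bsub>X\<^esub> act z = \<theta> \<cdot>\<^bsub>X\<^esub> M (p \<cdot>\<^bsub>X\<^esub> P z) k (p \<cdot>\<^bsub>X\<^esub> (u \<cdot>\<^bsub>X\<^esub> y))"
    using dk y unfolding descent_map_def by simp_all
  have g: "over_cod g" by simp
  let ?t = "q \<cdot>\<^bsub>X\<^esub> y \<cdot>\<^bsub>X\<^esub> k"
  have t: "?t \<in> Arr X" "Dom X ?t = Dom X (P z)" "Cod X ?t = Dom X g"
    using qy k by simp_all
  have "g \<cdot>\<^bsub>X\<^esub> ?t = g \<cdot>\<^bsub>X\<^esub> (q \<cdot>\<^bsub>X\<^esub> y) \<cdot>\<^bsub>X\<^esub> k"
    using qy k by (intro base.assoc[symmetric]) simp_all
  also have "\<dots> = p \<cdot>\<^bsub>X\<^esub> (u \<cdot>\<^bsub>X\<^esub> y \<cdot>\<^bsub>X\<^esub> k)"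
    unfolding square_comp[OF y] using y k by (intro base.assoc) simp_all
  finally have gt: "p \<cdot>\<^bsub>X\<^esub> P z = g \<cdot>\<^bsub>X\<^esub> ?t" unfolding k(4) ..
  obtain w where w: "w \<in> Arr X" "Dom X w = Dom X (P z)" "Cod X w = Dom X (P g)"
    "P g \<cdot>\<^bsub>X\<^esub> w = P z" "E g \<cdot>\<^bsub>X\<^esub> w = ?t"
    using pullback_lift[OF g, of "P z" ?t] z t gt by (metis P_over)
  have ka: "(P z, k, u \<cdot>\<^bsub>X\<^esub> y) \<in> Arr (slice X (Dom X p))" using z y k by simp
  have wa: "(P z, w, P g) \<in> Arr (slice X (Dom X p))" using z w by simp
  note mk = M_arr[OF postcomp_slice_arr[OF ka]] and mw = M_arr[OF postcomp_slice_arr[OF wa]]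
  note az = act_arr[OF z] and ag = act_arr[OF g]
  have pz: "over_cod (p \<cdot>\<^bsub>X\<^esub> P z)" and pg: "over_cod (p \<cdot>\<^bsub>X\<^esub> P g)" and
    puy: "over_cod (p \<cdot>\<^bsub>X\<^esub> (u \<cdot>\<^bsub>X\<^esub> y))" using z y by simp_all
  \<comment> \<open>Equivariance of \<open>w\<close>: both sides have second component \<open>q \<cdot> y \<cdot> k \<cdot> E (p \<cdot> P z)\<close>.\<close>
  have "w \<cdot>\<^bsub>X\<^esub> act z = act g \<cdot>\<^bsub>X\<^esub> M (p \<cdot>\<^bsub>X\<^esub> P z) w (p \<cdot>\<^bsub>X\<^esub> P g)"
  proof (rule pullback_eqI[OF g])
    have "P g \<cdot>\<^bsub>X\<^esub> (w \<cdot>\<^bsub>X\<^esub> act z) = P (p \<cdot>\<^bsub>X\<^esub> P z)"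
      using base.assoc[OF az(1) w(1) P_over(1)[OF g]] az w by simp
    moreover have "P g \<cdot>\<^bsub>X\<^esub> (act g \<cdot>\<^bsub>X\<^esub> M (p \<cdot>\<^bsub>X\<^esub> P z) w (p \<cdot>\<^bsub>X\<^esub> P g)) = P (p \<cdot>\<^bsub>X\<^esub> P z)"
      using base.assoc[OF mw(1) ag(1) P_over(1)[OF g]] ag mw by simp
    ultimately show "P g \<cdot>\<^bsub>X\<^esub> (w \<cdot>\<^bsub>X\<^esub> act z) =
        P g \<cdot>\<^bsub>X\<^esub> (act g \<cdot>\<^bsub>X\<^esub> M (p \<cdot>\<^bsub>X\<^esub> P z) w (p \<cdot>\<^bsub>X\<^esub> P g))" by simp
    have "E g \<cdot>\<^bsub>X\<^esub> (w \<cdot>\<^bsub>X\<^esub> act z) = ?t \<cdot>\<^bsub>X\<^esub> act z"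
      using base.assoc[OF az(1) w(1) E_arr(1)[OF g]] az w E_arr[OF g] by simp
    also have "\<dots> = q \<cdot>\<^bsub>X\<^esub> y \<cdot>\<^bsub>X\<^esub> (\<theta> \<cdot>\<^bsub>X\<^esub> M (p \<cdot>\<^bsub>X\<^esub> P z) k (p \<cdot>\<^bsub>X\<^esub> (u \<cdot>\<^bsub>X\<^esub> y)))"
      unfolding k(5)[symmetric] using az k qy by (intro base.assoc) simp_all
    also have "\<dots> = q \<cdot>\<^bsub>X\<^esub> y \<cdot>\<^bsub>X\<^esub> \<theta> \<cdot>\<^bsub>X\<^esub> M (p \<cdot>\<^bsub>X\<^esub> P z) k (p \<cdot>\<^bsub>X\<^esub> (u \<cdot>\<^bsub>X\<^esub> y))"
      using mk \<theta> qy by (intro base.assoc[symmetric]) simp_all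
    also have "q \<cdot>\<^bsub>X\<^esub> y \<cdot>\<^bsub>X\<^esub> \<theta> = q \<cdot>\<^bsub>X\<^esub> y \<cdot>\<^bsub>X\<^esub> E (p \<cdot>\<^bsub>X\<^esub> (u \<cdot>\<^bsub>X\<^esub> y))"
      using base.assoc[OF \<theta>(1) y(1) square_arr(2)] \<theta> y p'(4) by simp
    also have "\<dots> \<cdot>\<^bsub>X\<^esub> M (p \<cdot>\<^bsub>X\<^esub> P z) k (p \<cdot>\<^bsub>X\<^esub> (u \<cdot>\<^bsub>X\<^esub> y)) =
        q \<cdot>\<^bsub>X\<^esub> y \<cdot>\<^bsub>X\<^esub> (E (p \<cdot>\<^bsub>X\<^esub> (u \<cdot>\<^bsub>X\<^esub> y)) \<cdot>\<^bsub>X\<^esub> M (p \<cdot>\<^bsub>X\<^esub> P z) k (p \<cdot>\<^bsub>X\<^esub> (u \<cdot>\<^bsub>X\<^esub> y)))"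
      using mk qy E_arr[OF puy] y by (intro base.assoc) simp_all
    also have "\<dots> = ?t \<cdot>\<^bsub>X\<^esub> E (p \<cdot>\<^bsub>X\<^esub> P z)"
      unfolding E_natural[OF postcomp_slice_arr[OF ka]]
      using qy k E_arr[OF pz] z by (intro base.assoc[symmetric]) simp_all
    finally have lhs: "E g \<cdot>\<^bsub>X\<^esub> (w \<cdot>\<^bsub>X\<^esub> act z) = ?t \<cdot>\<^bsub>X\<^esub> E (p \<cdot>\<^bsub>X\<^esub> P z)" .
    have "E g \<cdot>\<^bsub>X\<^esub> (act g \<cdot>\<^bsub>X\<^esub> M (p \<cdot>\<^bsub>X\<^esub> P z) w (p \<cdot>\<^bsub>X\<^esub> P g)) =
        E g \<cdot>\<^bsub>X\<^esub> E (p \<cdot>\<^bsub>X\<^esub> P g) \<cdot>\<^bsub>X\<^esub> M (p \<cdot>\<^bsub>X\<^esub> P z) w (p \<cdot>\<^bsub>X\<^esub> P g)"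
      unfolding E_act[OF g, symmetric] using ag mw E_arr[OF g]
      by (intro base.assoc[symmetric]) simp_all
    also have "\<dots> = E g \<cdot>\<^bsub>X\<^esub> (E (p \<cdot>\<^bsub>X\<^esub> P g) \<cdot>\<^bsub>X\<^esub> M (p \<cdot>\<^bsub>X\<^esub> P z) w (p \<cdot>\<^bsub>X\<^esub> P g))"
      using mw E_arr[OF g] E_arr[OF pg] by (intro base.assoc) simp_all
    also have "\<dots> = E g \<cdot>\<^bsub>X\<^esub> w \<cdot>\<^bsub>X\<^esub> E (p \<cdot>\<^bsub>X\<^esub> P z)"
      unfolding E_natural[OF postcomp_slice_arr[OF wa]]
      using w E_arr[OF g] E_arr[OF pz] z by (intro base.assoc[symmetric]) simp_all
    finally show "E g \<cdot>\<^bsub>X\<^esub> (w \<cdot>\<^bsub>X\<^esub> act z) =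
        E g \<cdot>\<^bsub>X\<^esub> (act g \<cdot>\<^bsub>X\<^esub> M (p \<cdot>\<^bsub>X\<^esub> P z) w (p \<cdot>\<^bsub>X\<^esub> P g))"
      unfolding lhs w(5) ..
  qed (use w az ag mw in simp_all)
  then have "descent_map (P z) (act z) w (P g) (act g)"
    unfolding descent_map_def using w by simp
  then obtain f where fa: "(z, f, g) \<in> Arr (slice X (Cod X p))" and Mf: "M z f g = w"
    using full[unfolded descent_full_def, rule_format, OF z g] by blast
  have f: "f \<in> Arr X" "Cod X f = Dom X g" and gf: "g \<cdot>\<^bsub>X\<^esub> f = z" using fa by simp_all
  note pf = P'_arr[OF f, unfolded gf]
  \<comment> \<open>So \<open>k\<close> is an arrow over \<open>Dom q\<close>, not only over \<open>Dom p\<close>.\<close>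
  have yk: "y \<cdot>\<^bsub>X\<^esub> k = P' f"
  proof (rule square_eqI)
    show "y \<cdot>\<^bsub>X\<^esub> k \<in> Arr X" "P' f \<in> Arr X" "Dom X (y \<cdot>\<^bsub>X\<^esub> k) = Dom X (P' f)"
      "Cod X (y \<cdot>\<^bsub>X\<^esub> k) = Dom X q" "Cod X (P' f) = Dom X q"
      using y k(1-3) pf(1-3) by simp_all
    have "q \<cdot>\<^bsub>X\<^esub> (y \<cdot>\<^bsub>X\<^esub> k) = ?t"
      by (rule base.assoc[symmetric]) (use y k(1-3) in simp_all)
    also have "\<dots> = q \<cdot>\<^bsub>X\<^esub> P' f"
      unfolding pf(4) using E_natural[OF fa] unfolding Mf w(5) .
    finally show "q \<cdot>\<^bsub>X\<^esub> (y \<cdot>\<^bsub>X\<^esub> k) = q \<cdot>\<^bsub>X\<^esub> P' f" .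
    have "u \<cdot>\<^bsub>X\<^esub> (y \<cdot>\<^bsub>X\<^esub> k) = u \<cdot>\<^bsub>X\<^esub> y \<cdot>\<^bsub>X\<^esub> k"
      by (rule base.assoc[symmetric]) (use y k(1-3) in simp_all)
    then show "u \<cdot>\<^bsub>X\<^esub> (y \<cdot>\<^bsub>X\<^esub> k) = u \<cdot>\<^bsub>X\<^esub> P' f"
      unfolding k(4) pf(5) .
  qed
  have "pb.descent_map (pb.P f) (pb.act f) k y \<theta>"
    unfolding pb_simps pb_act[OF f] descent_map_postcomp[OF pf(1,3) y] gf pf(5)
    using dk yk by (rule conjI)
  then show "\<exists>f k. pb.over_cod f \<and> pb.descent_map (pb.P f) (pb.act f) k y \<theta> \<and> is_iso X k"
    using f iso by (intro exI[of _ f] exI[of _ k] conjI) simp_all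
qed

end

theorem effective_descent_stable_under_pullback:
  assumes X: "category X" and p: "effective_descent X p" and sq: "is_pullback X g p q u"
  shows "effective_descent X q"
proof -
  obtain R \<eta> \<epsilon> where parr: "p \<in> Arr X"
    and m: "monadic_adjunction (slice X (Dom X p)) (slice X (Cod X p)) (postcomp X p) R \<eta> \<epsilon>"
    using p unfolding effective_descent_def by blast
  interpret pullback_adjunction X p R \<eta> \<epsilon>
  proof (rule pullback_adjunction.intro[OF X])
    show "adjunction (slice X (Dom X p)) (slice X (Cod X p)) (postcomp X p) R \<eta> \<epsilon>"
      using m unfolding monadic_adjunction_def by blast
  qed (rule pullback_adjunction_axioms.intro[OF parr])
  interpret pulled_back_adjunction X p R \<eta> \<epsilon> g q u
    by unfold_locales (rule sq)
  have "monadic_adjunction (slice X (Dom X q)) (slice X (Cod X q)) (postcomp X q) R' \<eta>' \<epsilon>'"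
    using m unfolding monadic_iff pb.monadic_iff using pb_faithful pb_full pb_effective by blast
  moreover have "has_pullbacks_along X q"
    unfolding has_pullbacks_along_def using pb.pullback by blast
  ultimately show ?thesis
    unfolding effective_descent_def using square_arr(2) by blast
qed

theorem lemma11:
  fixes A :: "('oa, 'ma) cat" and C :: "('oc, 'mc) cat"
    and L :: "('oa, 'ma, 'oc, 'mc) func" and U :: "('oc, 'mc, 'oa, 'ma) func"
    and \<eta> :: "'oa \<Rightarrow> 'ma" and \<epsilon> :: "'oc \<Rightarrow> 'mc"
  assumes "adjunction A C L U \<eta> \<epsilon>"
    and "cartesian_nat_trans C C (L \<odot> U) id_func \<epsilon>"
  shows "preserves_effective_descent C C (L \<odot> U)"
  unfolding preserves_effective_descent_def
proof (intro allI impI)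
  fix p assume p: "effective_descent C p"
  interpret adjunction A C L U \<eta> \<epsilon> by (rule assms(1))
  have "p \<in> Hom C (Dom C p) (Cod C p)"
    using p by (simp add: effective_descent_def Hom_def)
  from assms(2)[unfolded cartesian_nat_trans_def, THEN conjunct2, rule_format, OF this]
  have "is_pullback C (\<epsilon> (Cod C p)) p (AMap (L \<odot> U) p) (\<epsilon> (Dom C p))"
    by (simp add: id_func_def)
  then show "effective_descent C (AMap (L \<odot> U) p)"
    by (rule effective_descent_stable_under_pullback[OF left.cod.category_axioms p])
qed

end
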